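(* Let $\mu_1,\mu_2,\lambda_1,\lambda_2,c>0$. For $\pi=(\pi_1,\pi_2)\in[0,1]^2$ let $g(\pi)=1-\pi_1\vee\pi_2$, $h(\pi)=c(\pi_1+\pi_2)$, $$V(\pi)=\inf_\tau\mathbb E_\pi\left[g(\Pi_\tau)+\int_0^\tau h(\Pi_s)\,ds\right],$$ let $\mathcal C=\{\pi\in[0,1]^2:V(\pi)<g(\pi)\}$ be the continuation region, and let $T=\{\pi\in[0,1]^2:\pi_1\le\pi_2\}$. Then there exists a function $b:[0,1]\to[0,1]$ with $b(\pi_1)\ge\pi_1$ for all $\pi_1\in[0,1]$ such that $$\mathcal C\cap T=\{\pi\in T:\pi_2<b(\pi_1)\}.$$ Moreover, $b$ is lower semi-continuous and first non-increasing and then non-decreasing.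
   Context: Set-up (two-dimensional quickest detection). For $\pi\in[0,1]^2$, under $\mathbb P_\pi$ (expectation $\mathbb E_\pi$): $Y^1,Y^2$ are continuous-time Markov chains on $\{0,1\}$, $Y^i$ having transition rate matrix $\begin{pmatrix}-\lambda_i&\lambda_i\\0&0\end{pmatrix}$ and $\mathbb P_\pi(Y^i_0=1)=\pi_i$; $W^1,W^2$ are standard Brownian motions; and $Y^1,Y^2,W^1,W^2$ are independent. One observes $X=(X^1,X^2)$ with $dX^i_t=\mu_iY^i_t\,dt+dW^i_t$, $X^i_0=0$, and $\mathcal F^X$ is the filtration generated by $X$. The posterior process $\Pi=(\Pi^1,\Pi^2)$ is $\Pi^i_t=\mathbb E_\pi[Y^i_t\mid\mathcal F^X_t]$ (continuous version); it satisfies $\Pi_0=\pi$ and $d\Pi^i_t=\lambda_i(1-\Pi^i_t)\,dt+\mu_i\Pi^i_t(1-\Pi^i_t)\,d\bar W^i_t$, where $\bar W^i_t=X^i_t-\mu_i\int_0^t\Pi^i_s\,ds$ and $(\bar W^1,\bar W^2)$ is a two-dimensional standard Brownian motion. The infimum in $V$ is over ($\mathbb P_\pi$-a.s. finite) $\mathcal F^X$-stopping times. "First non-increasing and then non-decreasing" means that $[0,1]$ splits into two consecutive intervals (one possibly empty), with $b$ non-increasing on the left one and non-decreasing on the right one. *)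

theory Defs
  imports "HOL-Probability.Probability"
begin

section \<open>Filtrations, Markov chains, Brownian motion\<close>

text \<open>Processes are indexed by real times, of which only times \<open>t \<ge> 0\<close> matter. The generated
  filtration (not augmented by null sets) is indexed by \<open>[0, \<infinity>]\<close>, so that \<^const>\<open>stopping_time\<close>
  covers stopping times which may take the value \<open>\<infinity>\<close>.\<close>

definition natural_filtration ::
    "'a set \<Rightarrow> (real \<Rightarrow> 'a \<Rightarrow> 'b::topological_space) \<Rightarrow> ennreal \<Rightarrow> 'a measure" where
  "natural_filtration \<Omega> X t =
     sigma \<Omega> {X s -` A \<inter> \<Omega> | s A. 0 \<le> s \<and> ennreal s \<le> t \<and> A \<in> sets borel}"

text \<open>\<open>p t = exp (t Q)\<close> on the finite state space \<open>S\<close>, as the solution of the forward equation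
  \<open>p' = p Q\<close>, \<open>p 0 = I\<close>.\<close>

definition transition_semigroup ::
    "real set \<Rightarrow> (real \<Rightarrow> real \<Rightarrow> real) \<Rightarrow> (real \<Rightarrow> real \<Rightarrow> real \<Rightarrow> real) \<Rightarrow> bool" where
  "transition_semigroup S Q p \<longleftrightarrow>
     (\<forall>x\<in>S. \<forall>y\<in>S. p 0 x y = of_bool (x = y)) \<and>
     (\<forall>t\<ge>0. \<forall>x\<in>S. \<forall>y\<in>S.
        ((\<lambda>s. p s x y) has_real_derivative (\<Sum>z\<in>S. p t x z * Q z y)) (at t within {0..}))"

definition markov_chain ::
    "'a measure \<Rightarrow> real set \<Rightarrow> (real \<Rightarrow> real \<Rightarrow> real) \<Rightarrow> (real \<Rightarrow> 'a \<Rightarrow> real) \<Rightarrow> bool" where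
  "markov_chain M S Q Y \<longleftrightarrow>
     (\<forall>t\<ge>0. Y t \<in> borel_measurable M) \<and>
     (\<forall>\<omega>\<in>space M. \<forall>t\<ge>0. Y t \<omega> \<in> S) \<and>
     (\<forall>\<omega>\<in>space M. \<forall>t\<ge>0. continuous (at_right t) (\<lambda>s. Y s \<omega>)) \<and>
     (\<exists>p. transition_semigroup S Q p \<and>
       (\<forall>s t y. 0 \<le> s \<and> s \<le> t \<and> y \<in> S \<longrightarrow>
         (AE \<omega> in M. real_cond_exp M (natural_filtration (space M) Y (ennreal s))
                         (\<lambda>\<omega>. of_bool (Y t \<omega> = y)) \<omega>
                     = p (t - s) (Y s \<omega>) y)))"

definition standard_brownian_motion :: "'a measure \<Rightarrow> (real \<Rightarrow> 'a \<Rightarrow> real) \<Rightarrow> bool" where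
  "standard_brownian_motion M W \<longleftrightarrow>
     (\<forall>t\<ge>0. W t \<in> borel_measurable M) \<and>
     (\<forall>\<omega>\<in>space M. W 0 \<omega> = 0 \<and> continuous_on {0..} (\<lambda>t. W t \<omega>)) \<and>
     (\<forall>s t. 0 \<le> s \<and> s < t \<longrightarrow>
        distributed M lborel (\<lambda>\<omega>. W t \<omega> - W s \<omega>) (normal_density 0 (sqrt (t - s)))) \<and>
     (\<forall>n (t::nat \<Rightarrow> real). 0 \<le> t 0 \<and> mono t \<longrightarrow>
        prob_space.indep_vars M (\<lambda>_. borel) (\<lambda>k \<omega>. W (t (Suc k)) \<omega> - W (t k) \<omega>) {..<n})"


section \<open>The detection problem\<close>

definition unit_square :: "(real^2) set" where
  "unit_square = {\<pi>. \<forall>i. 0 \<le> \<pi> $ i \<and> \<pi> $ i \<le> 1}"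

definition disorder_rate :: "real \<Rightarrow> real \<Rightarrow> real \<Rightarrow> real" where
  "disorder_rate l x y = (if x = 0 then (if y = 0 then - l else l) else 0)"

definition observation ::
    "real^2 \<Rightarrow> (2 \<Rightarrow> real \<Rightarrow> 'a \<Rightarrow> real) \<Rightarrow> (2 \<Rightarrow> real \<Rightarrow> 'a \<Rightarrow> real) \<Rightarrow> real \<Rightarrow> 'a \<Rightarrow> real^2" where
  "observation \<mu> Y W t \<omega> = (\<chi> i. \<mu> $ i * (LINT s:{0..t}|lborel. Y i s \<omega>) + W i t \<omega>)"

text \<open>The measurable space \<open>N\<close> and the processes \<open>Y\<close>, \<open>W\<close> on it are common to all \<open>\<pi>\<close>; the
  probability measure \<open>M \<pi>\<close> and the posterior process \<open>Post \<pi>\<close> depend on \<open>\<pi>\<close>.\<close>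

locale quickest_detection =
  fixes N :: "'a measure" and M :: "real^2 \<Rightarrow> 'a measure"
    and \<mu> lam :: "real^2"
    and Y W :: "2 \<Rightarrow> real \<Rightarrow> 'a \<Rightarrow> real"
    and Post :: "real^2 \<Rightarrow> real \<Rightarrow> 'a \<Rightarrow> real^2"
  assumes prob: "\<pi> \<in> unit_square \<Longrightarrow> prob_space (M \<pi>)"
    and sets_M: "\<pi> \<in> unit_square \<Longrightarrow> sets (M \<pi>) = sets N"
    and chain: "\<pi> \<in> unit_square \<Longrightarrow> markov_chain (M \<pi>) {0, 1} (disorder_rate (lam $ i)) (Y i)"
    and initial: "\<pi> \<in> unit_square \<Longrightarrow> measure (M \<pi>) {\<omega> \<in> space (M \<pi>). Y i 0 \<omega> = 1} = \<pi> $ i"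
    and brownian: "\<pi> \<in> unit_square \<Longrightarrow> standard_brownian_motion (M \<pi>) (W i)"
    and indep: "\<pi> \<in> unit_square \<Longrightarrow>
      prob_space.indep_vars (M \<pi>) (\<lambda>_. \<Pi>\<^sub>M t\<in>{0..}. borel)
        (\<lambda>k \<omega>. \<lambda>t\<in>{0..}. case k of Inl i \<Rightarrow> Y i t \<omega> | Inr i \<Rightarrow> W i t \<omega>) (UNIV :: (2 + 2) set)"
    and Post_cont: "\<pi> \<in> unit_square \<Longrightarrow> \<omega> \<in> space N \<Longrightarrow> continuous_on {0..} (\<lambda>t. Post \<pi> t \<omega>)"
    and Post_adapted: "\<pi> \<in> unit_square \<Longrightarrow> 0 \<le> t \<Longrightarrow>
      Post \<pi> t \<in> borel_measurable (natural_filtration (space N) (observation \<mu> Y W) (ennreal t))"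
    and Post_cond_exp: "\<pi> \<in> unit_square \<Longrightarrow> 0 \<le> t \<Longrightarrow>
      AE \<omega> in M \<pi>. Post \<pi> t \<omega> $ i =
        real_cond_exp (M \<pi>) (natural_filtration (space N) (observation \<mu> Y W) (ennreal t)) (Y i t) \<omega>"

definition g :: "real^2 \<Rightarrow> real" where
  "g \<pi> = 1 - max (\<pi> $ 1) (\<pi> $ 2)"

definition h :: "real \<Rightarrow> real^2 \<Rightarrow> real" where
  "h c \<pi> = c * (\<pi> $ 1 + \<pi> $ 2)"

definition admissible_times ::
    "'a measure \<Rightarrow> (real \<Rightarrow> 'a \<Rightarrow> real^2) \<Rightarrow> ('a \<Rightarrow> ennreal) set" where
  "admissible_times M X =
     {\<tau>. stopping_time (natural_filtration (space M) X) \<tau> \<and> (AE \<omega> in M. \<tau> \<omega> < \<infinity>)}"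

text \<open>The random cost is almost surely nonnegative and may have infinite expectation, so the
  expectation is taken as a nonnegative integral.\<close>

definition expected_cost ::
    "'a measure \<Rightarrow> real \<Rightarrow> (real \<Rightarrow> 'a \<Rightarrow> real^2) \<Rightarrow> ('a \<Rightarrow> ennreal) \<Rightarrow> ennreal" where
  "expected_cost M c P \<tau> =
     (\<integral>\<^sup>+\<omega>. ennreal (g (P (enn2real (\<tau> \<omega>)) \<omega>)
                    + (LINT s:{0..enn2real (\<tau> \<omega>)}|lborel. h c (P s \<omega>))) \<partial>M)"

definition value_function ::
    "(real^2 \<Rightarrow> 'a measure) \<Rightarrow> (real \<Rightarrow> 'a \<Rightarrow> real^2) \<Rightarrow> (real^2 \<Rightarrow> real \<Rightarrow> 'a \<Rightarrow> real^2)
      \<Rightarrow> real \<Rightarrow> real^2 \<Rightarrow> ennreal" where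
  "value_function M X Post c \<pi> =
     (INF \<tau> \<in> admissible_times (M \<pi>) X. expected_cost (M \<pi>) c (Post \<pi>) \<tau>)"

definition continuation_region ::
    "(real^2 \<Rightarrow> 'a measure) \<Rightarrow> (real \<Rightarrow> 'a \<Rightarrow> real^2) \<Rightarrow> (real^2 \<Rightarrow> real \<Rightarrow> 'a \<Rightarrow> real^2)
      \<Rightarrow> real \<Rightarrow> (real^2) set" where
  "continuation_region M X Post c =
     {\<pi> \<in> unit_square. value_function M X Post c \<pi> < ennreal (g \<pi>)}"

definition upper_triangle :: "(real^2) set" where
  "upper_triangle = {\<pi> \<in> unit_square. \<pi> $ 1 \<le> \<pi> $ 2}"


section \<open>Properties of the boundary\<close>

definition lower_semicontinuous_on :: "'b::topological_space set \<Rightarrow> ('b \<Rightarrow> real) \<Rightarrow> bool" where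
  "lower_semicontinuous_on S f \<longleftrightarrow>
     (\<forall>x\<in>S. \<forall>y<f x. eventually (\<lambda>z. y < f z) (at x within S))"

definition nonincreasing_then_nondecreasing_on :: "real set \<Rightarrow> (real \<Rightarrow> real) \<Rightarrow> bool" where
  "nonincreasing_then_nondecreasing_on S f \<longleftrightarrow>
     (\<exists>L R. is_interval L \<and> is_interval R \<and> L \<union> R = S \<and> (\<forall>x\<in>L. \<forall>y\<in>R. x < y) \<and>
        antimono_on L f \<and> mono_on R f)"

end

theory Submission
  imports Defs
begin

text \<open>
  For a fixed stopping time \<open>\<tau>\<close>, the expectation of \<open>g (\<Pi>\<^sub>\<tau>)\<close> is the least expectation of
  \<open>1 - Y\<^sup>d\<^sub>\<tau>\<close> over decisions \<open>d\<close> in \<open>{1, 2}\<close> based on the observations up to \<open>\<tau>\<close>. Hence \<open>V \<pi>\<close> is an infimum,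
  over pairs of a stopping time and a decision, of expectations under \<open>P\<^sub>\<pi>\<close> of costs which do not depend
  on \<open>\<pi>\<close>. By independence of the driving processes, \<open>P\<^sub>\<pi>\<close> is affine in each coordinate of \<open>\<pi>\<close>
  separately, so \<open>V\<close> is concave in each coordinate; the same representation gives upper semicontinuity in
  each coordinate. On \<open>T\<close> the function \<open>g\<close> is \<open>1 - \<pi>\<^sub>2\<close>: concavity in \<open>\<pi>\<^sub>2\<close> makes the stopping set
  upward closed, and concavity in \<open>\<pi>\<^sub>1\<close>, where \<open>g\<close> is constant, makes the boundary quasiconvex.
\<close>

section \<open>Right-continuous processes\<close>

text \<open>The posterior itself depends on the initial point, so costs written with
  \<open>Post \<pi>\<close> cannot be compared across \<pi> directly. They are rewritten as
  \<open>M \<pi>\<close>-measures of fixed events: an observed event intersected with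
  \<open>Y i t = 0\<close> or \<open>Y i t = 1\<close>. The posterior is given as a conditional
  expectation at deterministic times only. In place of optional sampling, stopping times are
  therefore rounded up to a grid, the fixed-time identity is applied on each slice, and path
  continuity with bounded \<open>g\<close> gives the limit; for the running cost, exchanging the
  time integral and the expectation leaves fixed times only. All events stay inside the
  \<sigma>-algebra of the driving processes, since nothing relates the measures
  \<open>M \<pi>\<close> on the rest of \<open>N\<close>. A further obstacle is that almost sure
  finiteness of a stopping time depends on \<pi>: it passes from an interior mixture to both
  endpoints, which is what concavity uses, but not from one endpoint to the mixture.\<close>

definition grid_time :: "nat \<Rightarrow> real \<Rightarrow> real" where
  "grid_time n s = real (Suc (nat \<lfloor>real (Suc n) * s\<rfloor>)) / real (Suc n)"

text \<open>Strictness is the point of adding one after the floor: the grid values approach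
  \<open>s\<close> inside \<open>at_right s\<close>, and a stopping time rounded this way is
  constant on events that are known by the rounded time.\<close>

lemma grid_time_gt: "s < grid_time n s"
proof -
  have "real (Suc n) * s < real (Suc (nat \<lfloor>real (Suc n) * s\<rfloor>))"
    by linarith
  then show ?thesis
    unfolding grid_time_def by (simp add: pos_less_divide_eq mult.commute del: of_nat_Suc)
qed

lemma grid_time_le:
  assumes "0 \<le> s" shows "grid_time n s \<le> s + 1 / real (Suc n)"
proof -
  have "real (Suc (nat \<lfloor>real (Suc n) * s\<rfloor>)) \<le> real (Suc n) * s + 1"
    using of_int_floor_le[of "real (Suc n) * s"] assms
    by (simp add: of_nat_nat del: of_int_floor_le)
  also have "\<dots> = (s + 1 / real (Suc n)) * real (Suc n)"
    by (simp add: field_simps)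
  finally show ?thesis
    unfolding grid_time_def by (subst pos_divide_le_eq) (simp_all del: of_nat_Suc)
qed

lemma grid_time_tendsto:
  assumes "0 \<le> s" shows "(\<lambda>n. grid_time n s) \<longlonglongrightarrow> s"
proof (rule tendsto_sandwich)
  show "\<forall>\<^sub>F n in sequentially. s \<le> grid_time n s"
    using grid_time_gt less_imp_le by (intro always_eventually) blast
  show "\<forall>\<^sub>F n in sequentially. grid_time n s \<le> s + 1 / real (Suc n)"
    using grid_time_le[OF assms] by (intro always_eventually) blast
  show "(\<lambda>n. s + 1 / real (Suc n)) \<longlonglongrightarrow> s"
    using tendsto_add[OF tendsto_const LIMSEQ_inverse_real_of_nat, of s]
    by (simp add: inverse_eq_divide)
qed auto

lemma right_continuous_grid_limit:
  fixes f :: "real \<Rightarrow> 'b::topological_space"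
  assumes "continuous (at_right s) f" "0 \<le> s"
  shows "(\<lambda>n. f (grid_time n s)) \<longlonglongrightarrow> f s"
proof -
  have "filterlim (\<lambda>n. grid_time n s) (at_right s) sequentially"
    unfolding filterlim_at using grid_time_tendsto[OF assms(2)] grid_time_gt
    by (auto intro!: always_eventually less_imp_neq[symmetric])
  moreover have "(f \<longlongrightarrow> f s) (at_right s)"
    using assms(1) by (simp add: continuous_within)
  ultimately show ?thesis
    by (rule filterlim_compose[rotated])
qed

text \<open>At a grid-rounded time only countably many random variables occur, so joint
  measurability is clear there; right-continuity passes it to the limit. The \<open>max 0\<close>
  extends the process to negative times, so that the time space can be all of
  \<open>borel\<close>.\<close>

lemma right_continuous_jointly_measurable:
  fixes U :: "real \<Rightarrow> 'a \<Rightarrow> 'b::metric_space"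
  assumes U: "\<And>t. 0 \<le> t \<Longrightarrow> U t \<in> borel_measurable M"
    and cont: "\<And>\<omega> t. \<omega> \<in> space M \<Longrightarrow> 0 \<le> t \<Longrightarrow> continuous (at_right t) (\<lambda>s. U s \<omega>)"
  shows "(\<lambda>x. U (max 0 (fst x)) (snd x)) \<in> borel_measurable (borel \<Otimes>\<^sub>M M)"
proof (rule borel_measurable_LIMSEQ_metric)
  fix n :: nat
  have [measurable]: "(\<lambda>x. U (real (Suc k) / real (Suc n)) (snd x)) \<in> borel_measurable (borel \<Otimes>\<^sub>M M)"
    for k :: nat
    by (rule measurable_compose[OF measurable_snd]) (rule U, simp)
  show "(\<lambda>x. U (grid_time n (max 0 (fst x))) (snd x)) \<in> borel_measurable (borel \<Otimes>\<^sub>M M)"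
    unfolding grid_time_def
    by (rule measurable_compose_countable
        [where f = "\<lambda>k x. U (real (Suc k) / real (Suc n)) (snd x)"]) measurable
next
  fix x :: "real \<times> 'a" assume "x \<in> space (borel \<Otimes>\<^sub>M M)"
  then have "snd x \<in> space M" by (auto simp: space_pair_measure)
  then show "(\<lambda>n. U (grid_time n (max 0 (fst x))) (snd x)) \<longlonglongrightarrow> U (max 0 (fst x)) (snd x)"
    using cont by (intro right_continuous_grid_limit[where f = "\<lambda>s. U s (snd x)"]) auto
qed

section \<open>Generated filtrations\<close>

lemma sets_natural_filtration:
  "sets (natural_filtration \<Omega> X t) =
     sigma_sets \<Omega> {X s -` A \<inter> \<Omega> | s A. 0 \<le> s \<and> ennreal s \<le> t \<and> A \<in> sets borel}"
  unfolding natural_filtration_def by (rule sets_measure_of) auto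

lemma space_natural_filtration [simp]: "space (natural_filtration \<Omega> X t) = \<Omega>"
  unfolding natural_filtration_def by (rule space_measure_of) auto

lemma natural_filtration_mono:
  "s \<le> t \<Longrightarrow> sets (natural_filtration \<Omega> X s) \<subseteq> sets (natural_filtration \<Omega> X t)"
  unfolding sets_natural_filtration by (intro sigma_sets_mono') (auto intro: order_trans)

lemma natural_filtration_subset:
  assumes "\<And>s. 0 \<le> s \<Longrightarrow> ennreal s \<le> t \<Longrightarrow> X s \<in> borel_measurable M" "space M = \<Omega>"
  shows "sets (natural_filtration \<Omega> X t) \<subseteq> sets M"
  unfolding sets_natural_filtration assms(2)[symmetric]
  by (rule sets.sigma_sets_subset) (auto intro: measurable_sets[OF assms(1)])

lemma measurable_natural_filtration:
  assumes "0 \<le> s" "ennreal s \<le> t"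
  shows "X s \<in> borel_measurable (natural_filtration \<Omega> X t)"
proof (rule measurableI)
  fix A :: "'b set" assume "A \<in> sets borel"
  with assms show "X s -` A \<inter> space (natural_filtration \<Omega> X t) \<in> sets (natural_filtration \<Omega> X t)"
    by (auto simp: sets_natural_filtration)
qed simp

section \<open>Mixtures of probability measures\<close>

text \<open>Relative to a family of events, because the measures compared later are related only on
  the events generated by the driving processes. With \<open>p = 0\<close> it expresses equality of
  \<open>P\<close> and \<open>P0\<close> there.\<close>

definition mixture_on :: "'a set set \<Rightarrow> real \<Rightarrow> 'a measure \<Rightarrow> 'a measure \<Rightarrow> 'a measure \<Rightarrow> bool" where
  "mixture_on \<A> p P P0 P1 \<longleftrightarrow>
     (\<forall>A\<in>\<A>. measure P A = (1 - p) * measure P0 A + p * measure P1 A)"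

lemma mixture_onI:
  "(\<And>A. A \<in> \<A> \<Longrightarrow> measure P A = (1 - p) * measure P0 A + p * measure P1 A) \<Longrightarrow> mixture_on \<A> p P P0 P1"
  by (simp add: mixture_on_def)

lemma mixture_onD:
  "mixture_on \<A> p P P0 P1 \<Longrightarrow> A \<in> \<A> \<Longrightarrow>
    measure P A = (1 - p) * measure P0 A + p * measure P1 A"
  by (simp add: mixture_on_def)

lemma mixture_on_CollectD:
  "mixture_on {f B | B. B \<in> S} p P P0 P1 \<Longrightarrow> B \<in> S \<Longrightarrow>
    measure P (f B) = (1 - p) * measure P0 (f B) + p * measure P1 (f B)"
  unfolding mixture_on_def by blast

text \<open>Dynkin's argument: both sides are countably additive, and complements are preserved
  because all three measures have total mass one and the weights \<open>1 - p\<close> and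
  \<open>p\<close> sum to one.\<close>

lemma mixture_on_sigma_sets:
  assumes prob: "prob_space P" "prob_space P0" "prob_space P1"
    and sets: "sets P0 = sets P" "sets P1 = sets P"
    and G: "Int_stable G" "G \<subseteq> sets P"
    and mix: "mixture_on G p P P0 P1"
  shows "mixture_on (sigma_sets (space P) G) p P P0 P1"
proof (rule mixture_onI)
  interpret P: prob_space P by fact
  interpret P0: prob_space P0 by fact
  interpret P1: prob_space P1 by fact
  note sp = sets_eq_imp_space_eq[OF sets(1)] sets_eq_imp_space_eq[OF sets(2)]
  have sub: "sigma_sets (space P) G \<subseteq> sets P"
    using G(2) by (rule sets.sigma_sets_subset)
  have "G \<subseteq> Pow (space P)"
    using G(2) sets.sets_into_space by blast
  fix A assume "A \<in> sigma_sets (space P) G"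
  from G(1) \<open>G \<subseteq> Pow (space P)\<close> this
  show "measure P A = (1 - p) * measure P0 A + p * measure P1 A"
  proof (induction rule: sigma_sets_induct_disjoint)
    case (basic A)
    then show ?case using mix by (rule mixture_onD[rotated])
  next
    case empty
    show ?case by simp
  next
    case (compl A)
    with sub have "A \<in> sets P" by auto
    then have "measure P (space P - A) = 1 - measure P A"
      "measure P0 (space P - A) = 1 - measure P0 A"
      "measure P1 (space P - A) = 1 - measure P1 A"
      using P.prob_compl[of A] P0.prob_compl[of A] P1.prob_compl[of A] by (simp_all add: sets sp)
    moreover have "1 - (a * x + b * y) = a * (1 - x) + b * (1 - y)" if "a = 1 - b" for a b x y :: real
      unfolding that by (simp add: algebra_simps)
    ultimately show ?case using compl by simp
  next
    case (union A)
    then have A: "range A \<subseteq> sets P" using sub by blast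
    have "(\<lambda>i. measure P0 (A i)) sums measure P0 (\<Union>i. A i)"
      "(\<lambda>i. measure P1 (A i)) sums measure P1 (\<Union>i. A i)"
      "(\<lambda>i. measure P (A i)) sums measure P (\<Union>i. A i)"
      using A union(1) sets
      by (auto intro!: P.finite_measure_UNION P0.finite_measure_UNION P1.finite_measure_UNION)
    then have "(\<lambda>i. (1 - p) * measure P0 (A i) + p * measure P1 (A i)) sums
        ((1 - p) * measure P0 (\<Union>i. A i) + p * measure P1 (\<Union>i. A i))"
      "(\<lambda>i. measure P (A i)) sums measure P (\<Union>i. A i)"
      by (auto intro!: sums_add sums_mult)
    then show ?case
      using union(3) sums_unique2 by fastforce
  qed
qed

text \<open>Finite-dimensional boxes are an intersection-stable generator of the product
  \<sigma>-algebra on paths, so the preceding extension applies to the laws of the path-valued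
  variable \<open>Z\<close>.\<close>

lemma mixture_on_process_law:
  fixes U :: "real \<Rightarrow> 'a \<Rightarrow> real"
  defines "Z \<equiv> \<lambda>\<omega>. \<lambda>t\<in>{0..}. U t \<omega>"
  assumes prob: "prob_space P" "prob_space P0" "prob_space P1"
    and sets: "sets P0 = sets P" "sets P1 = sets P"
    and U: "\<And>t. 0 \<le> t \<Longrightarrow> U t \<in> borel_measurable P"
    and fdd: "\<And>J A. finite J \<Longrightarrow> J \<subseteq> {0..} \<Longrightarrow> (\<And>t. t \<in> J \<Longrightarrow> A t \<in> sets borel) \<Longrightarrow>
      measure P {\<omega>\<in>space P. \<forall>t\<in>J. U t \<omega> \<in> A t} =
        (1 - p) * measure P0 {\<omega>\<in>space P. \<forall>t\<in>J. U t \<omega> \<in> A t} +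
        p * measure P1 {\<omega>\<in>space P. \<forall>t\<in>J. U t \<omega> \<in> A t}"
  shows "mixture_on {Z -` B \<inter> space P | B. B \<in> sets (\<Pi>\<^sub>M t\<in>{0..}. borel)} p P P0 P1"
proof -
  let ?S = "PiM {0::real..} (\<lambda>_. borel :: real measure)"
  have Z: "Z \<in> measurable P ?S"
    unfolding Z_def by (rule measurable_restrict) (auto intro: U)
  have Z0: "Z \<in> measurable P0 ?S" and Z1: "Z \<in> measurable P1 ?S"
    using Z measurable_cong_sets[OF sets(1) refl] measurable_cong_sets[OF sets(2) refl] by blast+
  note sp = sets_eq_imp_space_eq[OF sets(1)] sets_eq_imp_space_eq[OF sets(2)]
  let ?D = "\<lambda>Q. distr Q ?S Z"
  have meas: "measure (?D P) B = measure P (Z -` B \<inter> space P)"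
    "measure (?D P0) B = measure P0 (Z -` B \<inter> space P)"
    "measure (?D P1) B = measure P1 (Z -` B \<inter> space P)" if "B \<in> sets ?S" for B
    using that Z Z0 Z1 by (simp_all add: measure_distr sp)
  have pa: "prod_algebra {0::real..} (\<lambda>_. borel :: real measure) \<subseteq> sets ?S"
    unfolding sets_PiM by blast
  have gen: "mixture_on (prod_algebra {0..} (\<lambda>_. borel)) p (?D P) (?D P0) (?D P1)"
  proof (rule mixture_onI)
    fix B assume B: "B \<in> prod_algebra {0::real..} (\<lambda>_. borel :: real measure)"
    then obtain J A where A: "B = prod_emb {0..} (\<lambda>_. borel) J (\<Pi>\<^sub>E j\<in>J. A j)"
      "finite J" "J \<subseteq> {0..}" "\<And>i. i \<in> J \<Longrightarrow> A i \<in> sets borel"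
      by (rule prod_algebraE) auto
    have "Z -` B \<inter> space P = {\<omega>\<in>space P. \<forall>t\<in>J. U t \<omega> \<in> A t}"
    proof -
      have "(\<forall>t\<in>J. Z \<omega> t \<in> A t) \<longleftrightarrow> (\<forall>t\<in>J. U t \<omega> \<in> A t)" for \<omega>
        using A(3) by (intro ball_cong) (auto simp: Z_def)
      moreover have "Z \<omega> \<in> extensional {0..}" for \<omega>
        by (simp add: Z_def)
      ultimately show ?thesis
        unfolding A(1) prod_emb_def by (auto simp: PiE_iff)
    qed
    then show "measure (?D P) B = (1 - p) * measure (?D P0) B + p * measure (?D P1) B"
      using meas[of B] B pa fdd[OF A(2-4)] by auto
  qed
  have "mixture_on (sigma_sets (space (?D P)) (prod_algebra {0..} (\<lambda>_. borel))) p (?D P) (?D P0) (?D P1)"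
    using prob Z Z0 Z1 pa gen
    by (intro mixture_on_sigma_sets Int_stable_prod_algebra) (auto intro: prob_space.prob_space_distr)
  then have "mixture_on (sets ?S) p (?D P) (?D P0) (?D P1)"
    unfolding sets_PiM space_distr space_PiM .
  then show ?thesis
    using meas by (auto simp: mixture_on_def)
qed

text \<open>On a rectangle each measure factors, and only the factor of index \<open>m\<close>
  differs between the three laws; a product with a single affine factor is affine. Two varying
  factors would give a product of affine terms, which is why concavity is available only in each
  coordinate separately.\<close>

lemma mixture_on_independent:
  fixes Z :: "'k::finite \<Rightarrow> 'a \<Rightarrow> 'b"
  assumes prob: "prob_space P" "prob_space P0" "prob_space P1"
    and sets: "sets P0 = sets P" "sets P1 = sets P"
    and indep: "prob_space.indep_vars P S Z UNIV" "prob_space.indep_vars P0 S Z UNIV"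
      "prob_space.indep_vars P1 S Z UNIV"
    and mix: "mixture_on {Z m -` B \<inter> space P | B. B \<in> sets (S m)} p P P0 P1"
    and eq: "\<And>k B Q. k \<noteq> m \<Longrightarrow> B \<in> sets (S k) \<Longrightarrow> Q \<in> {P0, P1} \<Longrightarrow>
      measure Q (Z k -` B \<inter> space P) = measure P (Z k -` B \<inter> space P)"
  shows "mixture_on (sigma_sets (space P) {(\<Inter>k. Z k -` B k \<inter> space P) | B. \<forall>k. B k \<in> sets (S k)})
    p P P0 P1" (is "mixture_on (sigma_sets _ ?G) _ _ _ _")
proof (rule mixture_on_sigma_sets[OF prob sets])
  note sp = sets_eq_imp_space_eq[OF sets(1)] sets_eq_imp_space_eq[OF sets(2)]
  have rv: "Z k \<in> measurable P (S k)" for k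
    using indep(1) prob(1) by (simp add: prob_space.indep_vars_def)
  show "Int_stable ?G"
  proof (rule Int_stableI, safe)
    fix B C assume "\<forall>k. B k \<in> sets (S k)" "\<forall>k. C k \<in> sets (S k)"
    then show "\<exists>D. (\<Inter>k. Z k -` B k \<inter> space P) \<inter> (\<Inter>k. Z k -` C k \<inter> space P)
        = (\<Inter>k. Z k -` D k \<inter> space P) \<and> (\<forall>k. D k \<in> sets (S k))"
      by (intro exI[of _ "\<lambda>k. B k \<inter> C k"]) auto
  qed
  show "?G \<subseteq> sets P"
    using rv by (auto intro!: measurable_sets sets.countable_INT)
  show "mixture_on ?G p P P0 P1"
  proof (rule mixture_onI, safe)
    fix B assume B: "\<forall>k. B k \<in> sets (S k)"
    have *: "measure Q (\<Inter>k. Z k -` B k \<inter> space P) =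
        measure Q (Z m -` B m \<inter> space P) * (\<Prod>k\<in>UNIV - {m}. measure P (Z k -` B k \<inter> space P))"
      if "Q \<in> {P, P0, P1}" for Q
    proof -
      have "measure Q (\<Inter>k. Z k -` B k \<inter> space P) = (\<Prod>k\<in>UNIV. measure Q (Z k -` B k \<inter> space P))"
        using that prob indep B prob_space.indep_varsD_finite[of Q S Z UNIV B] sp by auto
      also have "\<dots> = measure Q (Z m -` B m \<inter> space P) *
          (\<Prod>k\<in>UNIV - {m}. measure Q (Z k -` B k \<inter> space P))"
        by (subst prod.remove[of _ m]) auto
      also have "(\<Prod>k\<in>UNIV - {m}. measure Q (Z k -` B k \<inter> space P)) =
          (\<Prod>k\<in>UNIV - {m}. measure P (Z k -` B k \<inter> space P))"
        using that B eq by (intro prod.cong) auto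
      finally show ?thesis .
    qed
    have "measure P (Z m -` B m \<inter> space P) =
        (1 - p) * measure P0 (Z m -` B m \<inter> space P) + p * measure P1 (Z m -` B m \<inter> space P)"
      using B by (intro mixture_onD[OF mix]) auto
    then show "measure P (\<Inter>k. Z k -` B k \<inter> space P) =
      (1 - p) * measure P0 (\<Inter>k. Z k -` B k \<inter> space P) + p * measure P1 (\<Inter>k. Z k -` B k \<inter> space P)"
      using *[of P] *[of P0] *[of P1] by (simp add: distrib_right mult.assoc del: INT_simps)
  qed
qed

section \<open>Laws of the driving processes\<close>

text \<open>The right-hand side mentions neither \<open>M\<close> nor \<open>W\<close>, which is
  what makes the law unique. Values of \<open>W\<close> are partial sums of independent increments
  since \<open>W 0 = 0\<close> and \<open>t 0 = 0\<close>. The times need only be monotone, so an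
  increment over an empty interval occurs and has the Dirac law at 0.\<close>

lemma prob_brownian_increments:
  fixes A :: "nat \<Rightarrow> real set" and t :: "nat \<Rightarrow> real"
  defines "\<nu> \<equiv> \<lambda>s u. if s < u then density lborel (\<lambda>x. ennreal (normal_density 0 (sqrt (u - s)) x))
    else return borel 0"
  assumes M: "prob_space M" and W: "standard_brownian_motion M W"
    and t: "t 0 = 0" "mono t" and n: "n > 0" and A: "\<And>k. A k \<in> sets borel"
  shows "measure M {\<omega>\<in>space M. \<forall>k<n. W (t k) \<omega> \<in> A k} =
    measure (PiM {..<n} (\<lambda>j. \<nu> (t j) (t (Suc j))))
      {x \<in> space (PiM {..<n} (\<lambda>_. borel)). \<forall>k<n. (\<Sum>j<k. x j) \<in> A k}"
proof -
  interpret M: prob_space M by fact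
  define D where "D = (\<lambda>k \<omega>. W (t (Suc k)) \<omega> - W (t k) \<omega>)"
  define B where "B = {x \<in> space (PiM {..<n} (\<lambda>_. borel :: real measure)). \<forall>k<n. (\<Sum>j<k. x j) \<in> A k}"
  have t0: "0 \<le> t k" for k
    using t monoD[OF t(2), of 0 k] by simp
  have W_meas: "W (t k) \<in> borel_measurable M" for k
    using W t0 by (simp add: standard_brownian_motion_def)
  then have D_meas [measurable]: "D k \<in> borel_measurable M" for k
    by (simp add: D_def)
  have "M.indep_vars (\<lambda>_. borel) D {..<n}"
    using W t0 t(2) unfolding standard_brownian_motion_def D_def by blast
  then have joint: "distr M (PiM {..<n} (\<lambda>_. borel)) (\<lambda>x. \<lambda>i\<in>{..<n}. D i x) = (\<Pi>\<^sub>M i\<in>{..<n}. distr M borel (D i))"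
    using n by (subst (asm) M.indep_vars_iff_distr_eq_PiM) auto
  have marginal: "distr M borel (D j) = \<nu> (t j) (t (Suc j))" for j
  proof (cases "t j < t (Suc j)")
    case True
    then have "distributed M lborel (D j) (normal_density 0 (sqrt (t (Suc j) - t j)))"
      using W t0[of j] unfolding standard_brownian_motion_def D_def by blast
    then have "distr M lborel (D j) = density lborel (normal_density 0 (sqrt (t (Suc j) - t j)))"
      by (rule distributed_distr_eq_density)
    moreover have "distr M borel (D j) = distr M lborel (D j)"
      by (rule distr_cong) auto
    ultimately show ?thesis
      using True by (simp add: \<nu>_def)
  next
    case False
    then have "t (Suc j) = t j"
      using monoD[OF t(2), of j "Suc j"] by simp
    then have "D j = (\<lambda>_. 0)"
      by (simp add: D_def)
    then show ?thesis
      using False by (simp add: \<nu>_def M.distr_const)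
  qed
  have tele: "W (t k) \<omega> = (\<Sum>j<k. D j \<omega>)" if "\<omega> \<in> space M" for k \<omega>
    using W that sum_lessThan_telescope[of "\<lambda>j. W (t j) \<omega>" k]
    by (simp add: standard_brownian_motion_def t(1) D_def)
  have B: "B \<in> sets (PiM {..<n} (\<lambda>_. borel))"
  proof -
    have "{x \<in> space (PiM {..<n} (\<lambda>_. borel :: real measure)). (\<Sum>j<k. x j) \<in> A k} \<in> sets (PiM {..<n} (\<lambda>_. borel))"
      if "k < n" for k
    proof -
      have "(\<lambda>x. \<Sum>j<k. x j) \<in> borel_measurable (PiM {..<n} (\<lambda>_. borel :: real measure))"
        using that by (intro borel_measurable_sum measurable_component_singleton) auto
      from measurable_sets[OF this A[of k]] show ?thesis
        by (simp add: vimage_def Int_def conj_commute)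
    qed
    moreover have "B = (\<Inter>k\<in>{..<n}. {x \<in> space (PiM {..<n} (\<lambda>_. borel :: real measure)). (\<Sum>j<k. x j) \<in> A k})"
      using n by (auto simp: B_def)
    ultimately show ?thesis
      using n by (auto intro!: sets.finite_INT)
  qed
  have "{\<omega>\<in>space M. \<forall>k<n. W (t k) \<omega> \<in> A k} = (\<lambda>x. \<lambda>i\<in>{..<n}. D i x) -` B \<inter> space M"
    using tele by (auto simp: B_def space_PiM)
  then have "measure M {\<omega>\<in>space M. \<forall>k<n. W (t k) \<omega> \<in> A k} =
      measure (distr M (PiM {..<n} (\<lambda>_. borel)) (\<lambda>x. \<lambda>i\<in>{..<n}. D i x)) B"
    using B by (subst measure_distr) (auto intro!: measurable_restrict)
  then show ?thesis
    unfolding joint B_def[symmetric] by (simp add: marginal)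
qed

lemma brownian_fdd_unique:
  assumes M: "prob_space M" "standard_brownian_motion M W"
    and M': "prob_space M'" "standard_brownian_motion M' W" "space M' = space M"
    and J: "finite J" "J \<subseteq> {0..}" and A: "\<And>t. t \<in> J \<Longrightarrow> A t \<in> sets borel"
  shows "measure M {\<omega>\<in>space M. \<forall>t\<in>J. W t \<omega> \<in> A t} = measure M' {\<omega>\<in>space M. \<forall>t\<in>J. W t \<omega> \<in> A t}"
proof -
  \<comment> \<open>Time 0 is added because the increment formula starts there.\<close>
  define xs where "xs = sorted_list_of_set (insert 0 J)"
  define n where "n = length xs"
  \<comment> \<open>The independence assumption on increments wants a monotone sequence on all of
    the naturals, so the list of times is continued by its last entry.\<close>
  define t where "t = (\<lambda>k. xs ! (min k (n - 1)))"
  \<comment> \<open>The added time 0 must not impose a constraint when it is not in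
    \<open>J\<close>.\<close>
  define A' where "A' = (\<lambda>k. if t k \<in> J then A (t k) else UNIV)"
  have set_xs: "set xs = insert 0 J" and sorted: "sorted xs"
    using J by (simp_all add: xs_def del: sorted_list_of_set_insert_remove)
  then have n: "n > 0"
    by (cases xs) (auto simp: n_def)
  have mono: "mono t"
  proof (rule monoI)
    fix i j :: nat assume "i \<le> j"
    then have "min i (n - 1) \<le> min j (n - 1)"
      by (rule min.mono) simp
    moreover have "n - 1 < length xs"
      using n by (simp add: n_def)
    then have "min j (n - 1) < length xs"
      by (rule le_less_trans[OF min.cobounded2])
    ultimately show "t i \<le> t j"
      unfolding t_def by (rule sorted_nth_mono[OF sorted])
  qed
  have "0 \<le> t 0"
  proof -
    have "t 0 \<in> set xs"
      using n by (auto simp: t_def n_def)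
    then show ?thesis
      using set_xs J(2) by auto
  qed
  have t_nth: "t k = xs ! k" if "k < n" for k
  proof -
    have "min k (n - 1) = k"
      using that by (intro min_absorb1) linarith
    then show ?thesis
      by (simp add: t_def)
  qed
  have range_t: "t ` {..<n} = insert 0 J"
    unfolding set_xs[symmetric] by (auto simp: t_nth n_def in_set_conv_nth image_iff)
  then obtain k where "t k = 0"
    by (metis imageE insertI1)
  with \<open>0 \<le> t 0\<close> have t0: "t 0 = 0"
    using monoD[OF mono, of 0 k] by simp
  have A': "A' k \<in> sets borel" for k
    using A by (simp add: A'_def)
  have "(\<forall>k<n. W (t k) \<omega> \<in> A' k) \<longleftrightarrow> (\<forall>s\<in>t ` {..<n}. s \<in> J \<longrightarrow> W s \<omega> \<in> A s)" for \<omega>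
    by (auto simp: A'_def)
  then have "(\<forall>t\<in>J. W t \<omega> \<in> A t) \<longleftrightarrow> (\<forall>k<n. W (t k) \<omega> \<in> A' k)" for \<omega>
    unfolding range_t by auto
  then show ?thesis
    using prob_brownian_increments[OF M t0 mono n A'] prob_brownian_increments[OF M'(1,2) t0 mono n A'] M'(3)
    by simp
qed

text \<open>State 1 is absorbing, and the waiting time in state 0 is exponential with rate
  \<open>l\<close>; \<open>r\<close> is the probability of being in state 0 at time
  \<open>t\<close>.\<close>

definition disorder_transition :: "real \<Rightarrow> real \<Rightarrow> real \<Rightarrow> real \<Rightarrow> real" where
  "disorder_transition l t x y =
     (let r = of_bool (x = 0) * exp (- l * t) in if y = 0 then r else 1 - r)"

text \<open>Two conserved quantities of the forward equation determine the solution: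
  \<open>p s x 0 * exp (l * s)\<close> and the row sum \<open>p s x 0 + p s x 1\<close>.\<close>

lemma transition_semigroup_disorder:
  assumes p: "transition_semigroup {0, 1} (disorder_rate l) p"
    and "0 \<le> t" "x \<in> {0, 1}" "y \<in> {0, 1}"
  shows "p t x y = disorder_transition l t x y"
proof -
  have p0: "p 0 x y = of_bool (x = y)" if "y \<in> {0, 1}" for y
    using p that assms(3) unfolding transition_semigroup_def by blast
  have deriv: "((\<lambda>s. p s x y) has_real_derivative (\<Sum>z\<in>{0, 1}. p s x z * disorder_rate l z y)) (at s within {0..})"
    if "0 \<le> s" "y \<in> {0, 1}" for s y
    using p that assms(3) unfolding transition_semigroup_def by blast
  have deriv0: "((\<lambda>s. p s x 0) has_real_derivative - l * p s x 0) (at s within {0..})" if "0 \<le> s" for s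
    using deriv[OF that, of 0] by (simp add: disorder_rate_def mult.commute)
  have deriv1: "((\<lambda>s. p s x 1) has_real_derivative l * p s x 0) (at s within {0..})" if "0 \<le> s" for s
    using deriv[OF that, of 1] by (simp add: disorder_rate_def mult.commute)
  have "\<exists>k. \<forall>s\<in>{0..}. p s x 0 * exp (l * s) = k"
    by (rule has_field_derivative_zero_constant)
      (auto intro!: derivative_eq_intros deriv0 simp: algebra_simps)
  then have 0: "p t x 0 = of_bool (x = 0) * exp (- l * t)"
  proof -
    have "p t x 0 * exp (l * t) = p 0 x 0"
    proof -
      obtain k where k: "\<And>s. 0 \<le> s \<Longrightarrow> p s x 0 * exp (l * s) = k"
        using \<open>\<exists>k. \<forall>s\<in>{0..}. p s x 0 * exp (l * s) = k\<close> by auto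
      show ?thesis
        using k[of t] k[of 0] \<open>0 \<le> t\<close> by simp
    qed
    then show ?thesis
      using p0[of 0] by (simp add: exp_minus field_simps)
  qed
  have "\<exists>k. \<forall>s\<in>{0..}. p s x 0 + p s x 1 = k"
    by (rule has_field_derivative_zero_constant)
      (auto intro!: derivative_eq_intros deriv0 deriv1)
  then have 1: "p t x 0 + p t x 1 = 1"
    using \<open>0 \<le> t\<close> p0[of 0] p0[of 1] \<open>x \<in> {0, 1}\<close> by force
  show ?thesis
    using assms(4) 0 1 by (auto simp: disorder_transition_def)
qed

text \<open>The Markov property integrated over an event \<open>A\<close> of the past. The
  coefficients are the same for every law with rate \<open>l\<close>, so this linear recursion
  carries any mixture relation forward in time.\<close>

lemma markov_chain_disorder_step:
  assumes M: "prob_space M" and Y: "markov_chain M {0, 1} (disorder_rate l) Y"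
    and st: "0 \<le> s" "s \<le> t" and y: "y \<in> {0, 1}"
    and A: "A \<in> sets (natural_filtration (space M) Y (ennreal s))"
  shows "measure M (A \<inter> {\<omega>\<in>space M. Y t \<omega> = y}) =
    (\<Sum>z\<in>{0, 1}. disorder_transition l (t - s) z y * measure M (A \<inter> {\<omega>\<in>space M. Y s \<omega> = z}))"
proof -
  interpret M: prob_space M by fact
  let ?F = "natural_filtration (space M) Y (ennreal s)"
  have Y_meas [measurable]: "Y u \<in> borel_measurable M" if "0 \<le> u" for u
    using Y that by (simp add: markov_chain_def)
  have sub: "sets ?F \<subseteq> sets M"
    using Y_meas by (intro natural_filtration_subset) auto
  interpret F: finite_measure_subalgebra M ?F
    by standard (use sub in \<open>auto simp: subalgebra_def\<close>)
  have A_meas [measurable]: "A \<in> sets M"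
    using A sub by auto
  have [measurable]: "Y t \<in> borel_measurable M" "Y s \<in> borel_measurable M"
    using st by (auto intro: Y_meas)
  have ev: "{\<omega>\<in>space M. Y u \<omega> = z} \<in> sets M" if "0 \<le> u" for u z
    using Y_meas[OF that] by measurable
  obtain p where p: "transition_semigroup {0, 1} (disorder_rate l) p"
    and cond: "AE \<omega> in M. real_cond_exp M ?F (\<lambda>\<omega>. of_bool (Y t \<omega> = y)) \<omega> = p (t - s) (Y s \<omega>) y"
    using Y st y unfolding markov_chain_def by blast
  have int: "integrable M (\<lambda>\<omega>. of_bool (Y t \<omega> = y) :: real)"
    by (rule M.integrable_const_bound[where B = 1]) auto
  have "measure M (A \<inter> {\<omega>\<in>space M. Y t \<omega> = y}) = (\<integral>\<omega>\<in>A. of_bool (Y t \<omega> = y) \<partial>M)"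
  proof -
    have "(\<integral>\<omega>\<in>A. of_bool (Y t \<omega> = y) \<partial>M) = (\<integral>\<omega>. indicat_real (A \<inter> {\<omega>\<in>space M. Y t \<omega> = y}) \<omega> \<partial>M)"
      unfolding set_lebesgue_integral_def
      by (rule Bochner_Integration.integral_cong) (auto simp: indicator_def)
    then show ?thesis
      using sets.sets_into_space[OF A_meas] by (simp add: Int_absorb2)
  qed
  also have "\<dots> = (\<integral>\<omega>\<in>A. real_cond_exp M ?F (\<lambda>\<omega>. of_bool (Y t \<omega> = y)) \<omega> \<partial>M)"
    by (rule F.real_cond_exp_intA[OF int A])
  also have "\<dots> = (\<integral>\<omega>. (\<Sum>z\<in>{0, 1}. disorder_transition l (t - s) z y *
      indicator (A \<inter> {\<omega>\<in>space M. Y s \<omega> = z}) \<omega>) \<partial>M)"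
    unfolding set_lebesgue_integral_def
  proof (rule integral_cong_AE)
    show "AE \<omega> in M. indicator A \<omega> *\<^sub>R real_cond_exp M ?F (\<lambda>\<omega>. of_bool (Y t \<omega> = y)) \<omega> =
      (\<Sum>z\<in>{0, 1}. disorder_transition l (t - s) z y * indicator (A \<inter> {\<omega>\<in>space M. Y s \<omega> = z}) \<omega>)"
      using cond
    proof eventually_elim
      case (elim \<omega>)
      show ?case
      proof (cases "\<omega> \<in> A")
        case True
        then have "\<omega> \<in> space M" using A_meas sets.sets_into_space by blast
        then have "Y s \<omega> \<in> {0, 1}" using Y st(1) by (simp add: markov_chain_def)
        then show ?thesis
          using elim transition_semigroup_disorder[OF p, of "t - s" "Y s \<omega>" y] st y True \<open>\<omega> \<in> space M\<close>
          by (auto simp: indicator_def)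
      qed simp
    qed
  next
    have [measurable]: "A \<inter> {\<omega>\<in>space M. Y s \<omega> = z} \<in> sets M" for z
      using ev[OF st(1)] by auto
    show "(\<lambda>\<omega>. \<Sum>z\<in>{0, 1}. disorder_transition l (t - s) z y *
        indicator (A \<inter> {\<omega>\<in>space M. Y s \<omega> = z}) \<omega>) \<in> borel_measurable M"
      by (intro borel_measurable_sum borel_measurable_times borel_measurable_const borel_measurable_indicator \<open>\<And>z. A \<inter> {\<omega>\<in>space M. Y s \<omega> = z} \<in> sets M\<close>)
  qed auto
  also have "\<dots> = (\<Sum>z\<in>{0, 1}. disorder_transition l (t - s) z y * measure M (A \<inter> {\<omega>\<in>space M. Y s \<omega> = z}))"
    using ev[OF st(1)] sets.sets_into_space[OF A_meas]
    by (subst Bochner_Integration.integral_sum)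
      (auto intro!: integrable_mult_right M.integrable_const_bound[where B = 1] simp: Int_absorb2)
  finally show ?thesis .
qed

text \<open>Induction over the times in increasing order. The laws share their transition
  probabilities, so the mixture relation at time 0 propagates through the linear one-step
  recursion.\<close>

lemma markov_chain_disorder_fdd_mixture:
  assumes prob: "prob_space P" "prob_space P0" "prob_space P1"
    and sets: "sets P0 = sets P" "sets P1 = sets P"
    and Y: "\<And>Q. Q \<in> {P, P0, P1} \<Longrightarrow> markov_chain Q {0, 1} (disorder_rate l) Y"
    and init: "mixture_on {{\<omega>\<in>space P. Y 0 \<omega> = y} | y. y \<in> {0, 1}} p P P0 P1"
    and J: "finite J" "J \<subseteq> {0..}" and A: "\<And>t. t \<in> J \<Longrightarrow> A t \<in> sets borel"
  shows "measure P {\<omega>\<in>space P. \<forall>t\<in>J. Y t \<omega> \<in> A t} =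
    (1 - p) * measure P0 {\<omega>\<in>space P. \<forall>t\<in>J. Y t \<omega> \<in> A t} +
    p * measure P1 {\<omega>\<in>space P. \<forall>t\<in>J. Y t \<omega> \<in> A t}"
proof -
  note sp = sets_eq_imp_space_eq[OF sets(1)] sets_eq_imp_space_eq[OF sets(2)]
  have space: "space Q = space P" if "Q \<in> {P, P0, P1}" for Q
    using sp that by auto
  define A' where "A' = (\<lambda>t. if t \<in> J then A t else UNIV)"
  have A': "A' t \<in> sets borel" for t using A by (simp add: A'_def)
  \<comment> \<open>The induction must record the state at the latest time as well, since the next
    step starts from it. Inserting 0 gives the induction its base case, the initial law, and keeps
    \<open>Max\<close> defined.\<close>
  define E where "E = (\<lambda>K y. {\<omega>\<in>space P. \<forall>t\<in>insert 0 K. Y t \<omega> \<in> A' t} \<inter> {\<omega>\<in>space P. Y (Max (insert 0 K)) \<omega> = y})"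
  have Y01: "Y t \<omega> \<in> {0, 1}" if "\<omega> \<in> space P" "0 \<le> t" for t \<omega>
    using Y[of P] that by (simp add: markov_chain_def)
  have Y_meas [measurable]: "Y t \<in> borel_measurable P" if "0 \<le> t" for t
    using Y[of P] that by (simp add: markov_chain_def)
  have main: "\<forall>y\<in>{0, 1}. measure P (E K y) = (1 - p) * measure P0 (E K y) + p * measure P1 (E K y)"
    if "finite K" "K \<subseteq> {0<..}" for K
    using that
  proof (induction rule: finite_linorder_max_induct)
    case empty
    have "E {} y = (if y \<in> A' 0 then {\<omega>\<in>space P. Y 0 \<omega> = y} else {})" for y
      by (auto simp: E_def)
    then show ?case
      using init by (auto simp: mixture_on_def)
  next
    case (insert b K)
    define m where "m = Max (insert 0 K)"
    have m: "0 \<le> m" "m \<le> b" "\<And>t. t \<in> insert 0 K \<Longrightarrow> 0 \<le> t \<and> t \<le> m"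
      using insert by (auto simp: m_def less_imp_le)
    have b: "Max (insert 0 (insert b K)) = b"
      using insert by (intro Max_eqI) (auto simp: less_imp_le)
    let ?G = "{\<omega>\<in>space P. \<forall>t\<in>insert 0 K. Y t \<omega> \<in> A' t}"
    have G: "?G \<in> sets (natural_filtration (space P) Y (ennreal m))"
    proof -
      have "{\<omega>\<in>space P. Y t \<omega> \<in> A' t} \<in> sets (natural_filtration (space P) Y (ennreal m))"
        if "t \<in> insert 0 K" for t
        using measurable_sets[OF measurable_natural_filtration[of t "ennreal m" Y "space P"] A'[of t]] m that
        by (simp add: vimage_def Int_def conj_commute ennreal_leI)
      then have "(\<Inter>t\<in>insert 0 K. {\<omega>\<in>space P. Y t \<omega> \<in> A' t}) \<in> sets (natural_filtration (space P) Y (ennreal m))"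
        using insert(1) by (intro sets.finite_INT) auto
      moreover have "?G = (\<Inter>t\<in>insert 0 K. {\<omega>\<in>space P. Y t \<omega> \<in> A' t})"
        by auto
      ultimately show ?thesis by simp
    qed
    have E_b: "E (insert b K) y = (if y \<in> A' b then ?G \<inter> {\<omega>\<in>space P. Y b \<omega> = y} else {})" for y
      unfolding E_def b by auto
    have E_K: "E K z = ?G \<inter> {\<omega>\<in>space P. Y m \<omega> = z}" for z
      by (simp add: E_def m_def)
    \<comment> \<open>Once the state at \<open>b\<close> is fixed to be \<open>y\<close>, the
      constraint at time \<open>b\<close> is the deterministic factor
      \<open>of_bool (y \<in> A' b)\<close>.\<close>
    define r where "r = (\<lambda>z y. of_bool (y \<in> A' b) * disorder_transition l (b - m) z y)"
    have step: "measure Q (E (insert b K) y) = r 0 y * measure Q (E K 0) + r 1 y * measure Q (E K 1)"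
      if "y \<in> {0, 1}" "Q \<in> {P, P0, P1}" for y Q
      using markov_chain_disorder_step[of Q l Y m b y ?G] prob Y[OF that(2)] m that G space[OF that(2)]
      by (auto simp: E_b E_K r_def)
    have IH: "measure P (E K z) = (1 - p) * measure P0 (E K z) + p * measure P1 (E K z)" if "z \<in> {0, 1}" for z
      using insert that by auto
    show ?case
    proof
      fix y :: real assume "y \<in> {0, 1}"
      note step' = step[OF this]
      have "measure P (E (insert b K) y) =
        r 0 y * ((1 - p) * measure P0 (E K 0) + p * measure P1 (E K 0)) +
        r 1 y * ((1 - p) * measure P0 (E K 1) + p * measure P1 (E K 1))"
        using step'[of P] IH[of 0] IH[of 1] by simp
      also have "\<dots> = (1 - p) * (r 0 y * measure P0 (E K 0) + r 1 y * measure P0 (E K 1)) +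
        p * (r 0 y * measure P1 (E K 0) + r 1 y * measure P1 (E K 1))"
        by (simp add: algebra_simps)
      also have "\<dots> = (1 - p) * measure P0 (E (insert b K) y) + p * measure P1 (E (insert b K) y)"
        using step'[of P0] step'[of P1] by simp
      finally show "measure P (E (insert b K) y) =
        (1 - p) * measure P0 (E (insert b K) y) + p * measure P1 (E (insert b K) y)" .
    qed
  qed
  let ?K = "J - {0}"
  have E_meas: "E ?K y \<in> sets P" for y
  proof -
    have "0 \<le> Max (insert 0 ?K)" using J by (intro Max_ge) auto
    then have [measurable]: "Y (Max (insert 0 ?K)) \<in> borel_measurable P" by (rule Y_meas)
    have "{\<omega>\<in>space P. Y t \<omega> \<in> A' t} \<in> sets P" if "t \<in> insert 0 ?K" for t
    proof -
      have "Y t \<in> borel_measurable P" using that J by (intro Y_meas) auto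
      then show ?thesis using measurable_sets[OF _ A'[of t]] by (simp add: vimage_def Int_def conj_commute)
    qed
    then have "(\<Inter>t\<in>insert 0 ?K. {\<omega>\<in>space P. Y t \<omega> \<in> A' t}) \<in> sets P"
      using J(1) by (intro sets.finite_INT) auto
    moreover have "{\<omega>\<in>space P. \<forall>t\<in>insert 0 ?K. Y t \<omega> \<in> A' t} = (\<Inter>t\<in>insert 0 ?K. {\<omega>\<in>space P. Y t \<omega> \<in> A' t})"
      by auto
    ultimately have "{\<omega>\<in>space P. \<forall>t\<in>insert 0 ?K. Y t \<omega> \<in> A' t} \<in> sets P"
      by simp
    then show ?thesis unfolding E_def by (rule sets.Int) measurable
  qed
  have "{\<omega>\<in>space P. \<forall>t\<in>J. Y t \<omega> \<in> A t} = {\<omega>\<in>space P. \<forall>t\<in>insert 0 ?K. Y t \<omega> \<in> A' t}"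
    by (auto simp: A'_def)
  also have "\<dots> = E ?K 0 \<union> E ?K 1"
    using Y01[of _ "Max (insert 0 ?K)"] J by (auto simp: E_def)
  finally have split: "{\<omega>\<in>space P. \<forall>t\<in>J. Y t \<omega> \<in> A t} = E ?K 0 \<union> E ?K 1" .
  have "measure Q {\<omega>\<in>space P. \<forall>t\<in>J. Y t \<omega> \<in> A t} = measure Q (E ?K 0) + measure Q (E ?K 1)"
    if "Q \<in> {P, P0, P1}" for Q
  proof -
    interpret Q: prob_space Q using that prob by auto
    show ?thesis
      unfolding split
    proof (rule Q.finite_measure_Union)
      show "E ?K 0 \<in> sets Q" "E ?K 1 \<in> sets Q"
        using E_meas[of 0] E_meas[of 1] that unfolding insert_iff by (metis sets empty_iff)+
      show "E ?K 0 \<inter> E ?K 1 = {}"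
      proof (rule equals0I)
        fix \<omega> assume "\<omega> \<in> E ?K 0 \<inter> E ?K 1"
        then have "Y (Max (insert 0 ?K)) \<omega> = 0" "Y (Max (insert 0 ?K)) \<omega> = 1"
          unfolding E_def by blast+
        then show False
          by simp
      qed
    qed
  qed
  note sum = this[of P] this[of P0] this[of P1]
  have "measure P (E ?K y) = (1 - p) * measure P0 (E ?K y) + p * measure P1 (E ?K y)"
    if "y \<in> {0, 1}" for y
  proof -
    have "finite ?K" "?K \<subseteq> {0<..}"
      using J by (auto simp: less_le)
    from main[OF this] that show ?thesis by (rule bspec)
  qed
  from this[of 0] this[of 1] sum show ?thesis
    by (simp add: distrib_left)
qed

section \<open>The detection problem\<close>

lemma borel_measurable_vec_lambda:
  fixes f :: "'n::finite \<Rightarrow> 'a \<Rightarrow> real"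
  assumes "\<And>i. f i \<in> borel_measurable M"
  shows "(\<lambda>x. \<chi> i. f i x) \<in> borel_measurable M"
proof (rule borel_measurable_euclidean_space[THEN iffD2], rule ballI)
  fix b :: "real ^ 'n" assume "b \<in> Basis"
  then obtain i where "b = axis i 1"
    by (auto simp: Basis_vec_def)
  then show "(\<lambda>x. (\<chi> i. f i x) \<bullet> b) \<in> borel_measurable M"
    using assms[of i] by (simp add: inner_axis)
qed

lemma borel_measurable_vec_nth [measurable (raw)]:
  fixes f :: "'a \<Rightarrow> real ^ 'n::finite"
  assumes "f \<in> borel_measurable M"
  shows "(\<lambda>x. f x $ i) \<in> borel_measurable M"
  using assms
  by (rule measurable_compose)
    (rule borel_measurable_continuous_onI[OF continuous_on_component[OF continuous_on_id]])

text \<open>The other coordinate is held fixed: the law of the drivers is affine in each initial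
  probability, but not jointly in both.\<close>

definition coordinate_mixture ::
    "2 \<Rightarrow> real \<Rightarrow> real^2 \<Rightarrow> real^2 \<Rightarrow> real^2 \<Rightarrow> bool" where
  "coordinate_mixture i p \<pi> \<pi>0 \<pi>1 \<longleftrightarrow>
     \<pi> \<in> unit_square \<and> \<pi>0 \<in> unit_square \<and> \<pi>1 \<in> unit_square \<and> 0 \<le> p \<and> p \<le> 1 \<and>
     \<pi> $ i = (1 - p) * \<pi>0 $ i + p * \<pi>1 $ i \<and> (\<forall>j. j \<noteq> i \<longrightarrow> \<pi>0 $ j = \<pi> $ j \<and> \<pi>1 $ j = \<pi> $ j)"

lemma suminf_mono_ennreal:
  fixes f g :: "nat \<Rightarrow> ennreal"
  shows "(\<And>n. f n \<le> g n) \<Longrightarrow> suminf f \<le> suminf g"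
  by (rule suminf_le) (auto intro: summableI)

lemma borel_measurable_g: "f \<in> borel_measurable M \<Longrightarrow> (\<lambda>x. g (f x)) \<in> borel_measurable M"
  unfolding g_def by (intro borel_measurable_diff borel_measurable_max borel_measurable_vec_nth) auto

lemma borel_measurable_h: "f \<in> borel_measurable M \<Longrightarrow> (\<lambda>x. h c (f x)) \<in> borel_measurable M"
  unfolding h_def
  by (intro borel_measurable_add borel_measurable_times borel_measurable_vec_nth) auto

lemma g_le: "g x \<le> 1 - x $ i"
  using exhaust_2[of i] by (auto simp: g_def)

lemma g_le_one: "x \<in> unit_square \<Longrightarrow> g x \<le> 1"
  using g_le[of x 1] by (auto simp: unit_square_def intro: order_trans)

lemma g_nonneg: "x \<in> unit_square \<Longrightarrow> 0 \<le> g x"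
  by (simp add: g_def unit_square_def)

lemma continuous_on_g: "continuous_on UNIV g"
  unfolding g_def[abs_def] by (intro continuous_intros continuous_on_max)

text \<open>The left part consists of the points that some later point strictly undercuts. If
  \<open>y\<close> undercuts \<open>x\<close> and \<open>x' \<le> x\<close>, quasiconvexity between
  \<open>x'\<close> and \<open>y\<close> forces \<open>f x \<le> f x'\<close>, so the left part is
  an initial segment on which \<open>f\<close> is non-increasing; on its complement \<open>f\<close>
  is non-decreasing by construction. This avoids choosing a minimiser, which the hypotheses do not
  provide.\<close>

lemma quasiconvex_imp_nonincreasing_then_nondecreasing:
  assumes S: "is_interval S"
    and f: "\<And>x y z. x \<in> S \<Longrightarrow> y \<in> S \<Longrightarrow> x \<le> z \<Longrightarrow> z \<le> y \<Longrightarrow> f z \<le> max (f x) (f y)"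
  shows "nonincreasing_then_nondecreasing_on S f"
proof -
  let ?L = "{x\<in>S. \<exists>y\<in>S. x < y \<and> f y < f x}" and ?R = "{x\<in>S. \<forall>y\<in>S. x < y \<longrightarrow> f x \<le> f y}"
  have L: "f x \<le> f x' \<and> x' \<in> ?L" if "x' \<in> S" "x' \<le> x" "x \<in> ?L" for x x'
  proof -
    obtain y where y: "y \<in> S" "x < y" "f y < f x"
      using \<open>x \<in> ?L\<close> by blast
    with f[of x' y x] that have "f x \<le> f x'"
      by (auto simp: max_def split: if_splits)
    moreover from this y that have "f y < f x'" "x' < y"
      by linarith+
    ultimately show ?thesis
      using \<open>x' \<in> S\<close> \<open>y \<in> S\<close> by blast
  qed
  have betw: "z \<in> S" if "x \<in> S" "y \<in> S" "x \<le> z" "z \<le> y" for x y z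
    using S that unfolding is_interval_1 by blast
  have LR: "x < y" if "x \<in> ?L" "y \<in> ?R" for x y
  proof (rule ccontr)
    assume "\<not> x < y"
    moreover have "y \<in> S"
      using \<open>y \<in> ?R\<close> by blast
    ultimately have "y \<in> ?L"
      using L[of y x] \<open>x \<in> ?L\<close> by (simp only: not_less)
    then obtain z where "z \<in> S" "y < z" "f z < f y"
      by blast
    moreover from this have "f y \<le> f z"
      using \<open>y \<in> ?R\<close> by blast
    ultimately show False
      by linarith
  qed
  have "is_interval ?L"
    unfolding is_interval_1
  proof (intro ballI allI impI, elim conjE)
    fix a b x assume "a \<in> ?L" "b \<in> ?L" "a \<le> x" "x \<le> b"
    moreover from this have "x \<in> S"
      using betw[of a b x] by blast
    ultimately show "x \<in> ?L"
      using L[of x b] by blast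
  qed
  moreover have "is_interval ?R"
    unfolding is_interval_1
  proof (intro ballI allI impI, elim conjE)
    fix a b x assume "a \<in> ?R" "b \<in> ?R" "a \<le> x" "x \<le> b"
    moreover from this have "x \<in> S"
      using betw[of a b x] by blast
    moreover have "x \<notin> ?L"
      using LR[of x a] \<open>a \<in> ?R\<close> \<open>a \<le> x\<close> by (auto dest: leD)
    ultimately show "x \<in> ?R"
      using not_less by blast
  qed
  moreover have "?L \<union> ?R = S"
    using not_less by blast
  moreover have "antimono_on ?L f"
    using L by (intro monotone_onI) blast
  moreover have "mono_on ?R f"
    by (intro monotone_onI) (auto simp: le_less)
  moreover have "\<forall>x\<in>?L. \<forall>y\<in>?R. x < y"
    using LR by blast
  ultimately show ?thesis
    unfolding nonincreasing_then_nondecreasing_on_def by (intro exI conjI)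
qed

context quickest_detection
begin

subsection \<open>The observed filtration and the posterior\<close>

definition driver :: "2 + 2 \<Rightarrow> 'a \<Rightarrow> real \<Rightarrow> real" where
  "driver k \<omega> = (\<lambda>t\<in>{0..}. case k of Inl i \<Rightarrow> Y i t \<omega> | Inr i \<Rightarrow> W i t \<omega>)"

text \<open>The largest collection of events on which the laws for different initial points are
  compared. Its generator consists of the rectangles to which independence applies directly.\<close>

definition driving_algebra :: "'a measure" where
  "driving_algebra = sigma (space N)
     {(\<Inter>k. driver k -` B k \<inter> space N) | B. \<forall>k. B k \<in> sets (\<Pi>\<^sub>M t\<in>{0..}. borel)}"

abbreviation observed :: "ennreal \<Rightarrow> 'a measure" where
  "observed \<equiv> natural_filtration (space N) (observation \<mu> Y W)"

lemma space_M: "\<pi> \<in> unit_square \<Longrightarrow> space (M \<pi>) = space N"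
  using sets_M by (rule sets_eq_imp_space_eq)

lemma space_driving [simp]: "space driving_algebra = space N"
  unfolding driving_algebra_def by (rule space_measure_of) auto

lemma sets_driving: "sets driving_algebra = sigma_sets (space N)
     {(\<Inter>k. driver k -` B k \<inter> space N) | B. \<forall>k. B k \<in> sets (\<Pi>\<^sub>M t\<in>{0..}. borel)}"
  unfolding driving_algebra_def by (rule sets_measure_of) auto

lemma measurable_M: "\<pi> \<in> unit_square \<Longrightarrow> measurable (M \<pi>) S = measurable N S"
  by (rule measurable_cong_sets[OF sets_M refl])

text \<open>Measurability and path properties of \<open>Y\<close> and \<open>W\<close> are assumed
  under the measures \<open>M \<pi>\<close>; one concrete point of the square transfers them to
  \<open>N\<close>.\<close>

lemma zero_in_unit_square: "0 \<in> unit_square"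
  by (simp add: unit_square_def)

lemma Y_meas_N: "0 \<le> t \<Longrightarrow> Y i t \<in> borel_measurable N"
  using chain[OF zero_in_unit_square, of i]
  by (simp add: markov_chain_def measurable_M[OF zero_in_unit_square])

lemma Y_values: "\<omega> \<in> space N \<Longrightarrow> 0 \<le> t \<Longrightarrow> Y i t \<omega> \<in> {0, 1}"
  using chain[OF zero_in_unit_square, of i] space_M[OF zero_in_unit_square]
  by (simp add: markov_chain_def)

lemma Y_right_continuous: "\<omega> \<in> space N \<Longrightarrow> 0 \<le> t \<Longrightarrow> continuous (at_right t) (\<lambda>s. Y i s \<omega>)"
  using chain[OF zero_in_unit_square, of i] space_M[OF zero_in_unit_square]
  by (simp add: markov_chain_def)

lemma W_meas_N: "0 \<le> t \<Longrightarrow> W i t \<in> borel_measurable N"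
  using brownian[OF zero_in_unit_square, of i]
  by (simp add: standard_brownian_motion_def measurable_M[OF zero_in_unit_square])

lemma driver_measurable_N: "driver k \<in> measurable N (\<Pi>\<^sub>M t\<in>{0..}. borel)"
  unfolding driver_def
  by (rule measurable_restrict, cases k) (simp_all add: Y_meas_N W_meas_N)

lemma driver_measurable: "driver k \<in> measurable driving_algebra (\<Pi>\<^sub>M t\<in>{0..}. borel)"
proof (rule measurableI)
  let ?S = "PiM {0::real..} (\<lambda>_. borel :: real measure)"
  fix \<omega> assume "\<omega> \<in> space driving_algebra"
  then show "driver k \<omega> \<in> space ?S"
    by (intro measurable_space[OF driver_measurable_N]) simp
next
  let ?S = "PiM {0::real..} (\<lambda>_. borel :: real measure)"
  fix A assume A: "A \<in> sets ?S"
  have "driver k -` A \<inter> space N = (\<Inter>j. driver j -` (if j = k then A else space ?S) \<inter> space N)"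
  proof (intro set_eqI iffI)
    fix \<omega> assume "\<omega> \<in> driver k -` A \<inter> space N"
    then show "\<omega> \<in> (\<Inter>j. driver j -` (if j = k then A else space ?S) \<inter> space N)"
      using measurable_space[OF driver_measurable_N, of \<omega>] by simp
  next
    fix \<omega> assume "\<omega> \<in> (\<Inter>j. driver j -` (if j = k then A else space ?S) \<inter> space N)"
    then have "\<omega> \<in> driver k -` (if k = k then A else space ?S) \<inter> space N"
      by (rule INT_D) simp
    then show "\<omega> \<in> driver k -` A \<inter> space N" by simp
  qed
  moreover have "\<forall>j. (if j = k then A else space ?S) \<in> sets ?S"
    using A by auto
  ultimately have "driver k -` A \<inter> space N \<in>
      {(\<Inter>k. driver k -` B k \<inter> space N) | B. \<forall>k. B k \<in> sets ?S}"
    unfolding mem_Collect_eq by (intro exI conjI)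
  then show "driver k -` A \<inter> space driving_algebra \<in> sets driving_algebra"
    by (simp add: sets_driving)
qed

lemma driver_component_measurable:
  assumes "0 \<le> t" shows "(\<lambda>\<omega>. driver k \<omega> t) \<in> borel_measurable driving_algebra"
  by (rule measurable_compose[OF driver_measurable measurable_component_singleton]) (use assms in simp)

lemma Y_measurable: "0 \<le> t \<Longrightarrow> Y i t \<in> borel_measurable driving_algebra"
  using driver_component_measurable[of t "Inl i"] by (simp add: driver_def)

lemma W_measurable: "0 \<le> t \<Longrightarrow> W i t \<in> borel_measurable driving_algebra"
  using driver_component_measurable[of t "Inr i"] by (simp add: driver_def)

lemma driving_subset: "sets driving_algebra \<subseteq> sets N"
  unfolding sets_driving
proof (rule sets.sigma_sets_subset, safe)
  fix B :: "2 + 2 \<Rightarrow> (real \<Rightarrow> real) set"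
  assume "\<forall>k. B k \<in> sets (\<Pi>\<^sub>M t\<in>{0::real..}. borel)"
  then show "(\<Inter>k. driver k -` B k \<inter> space N) \<in> sets N"
    by (intro sets.finite_INT) (auto intro: measurable_sets[OF driver_measurable_N])
qed

text \<open>The drift is a time integral of \<open>Y\<close>, and right-continuity of
  \<open>Y\<close> makes it jointly measurable, so the integral is measurable in the outcome.
  Observed events thereby fall under the mixture formula.\<close>

lemma observation_measurable:
  assumes "0 \<le> t"
  shows "observation \<mu> Y W t \<in> borel_measurable driving_algebra"
proof -
  have "(\<lambda>\<omega>. LINT s:{0..t}|lborel. Y i s \<omega>) \<in> borel_measurable driving_algebra" for i
  proof -
    have "(\<lambda>x. Y i (max 0 (fst x)) (snd x)) \<in> borel_measurable (borel \<Otimes>\<^sub>M driving_algebra)"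
      using Y_right_continuous by (intro right_continuous_jointly_measurable Y_measurable) auto
    from measurable_compose[OF _ this, of "\<lambda>x. (snd x, fst x)" "driving_algebra \<Otimes>\<^sub>M lborel"]
    have [measurable]: "(\<lambda>(\<omega>, s). Y i (max 0 s) \<omega>) \<in> borel_measurable (driving_algebra \<Otimes>\<^sub>M lborel)"
      by (simp add: split_beta' measurable_lborel1)
    have "(\<lambda>\<omega>. \<integral>s. indicator {0..t} s *\<^sub>R Y i (max 0 s) \<omega> \<partial>lborel) \<in> borel_measurable driving_algebra"
      by measurable
    moreover have "(LINT s:{0..t}|lborel. Y i s \<omega>) = (\<integral>s. indicator {0..t} s *\<^sub>R Y i (max 0 s) \<omega> \<partial>lborel)" for \<omega>
      unfolding set_lebesgue_integral_def
      by (rule Bochner_Integration.integral_cong) (auto simp: indicator_def)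
    ultimately show ?thesis by simp
  qed
  with W_measurable[OF assms] show ?thesis
    unfolding observation_def by (intro borel_measurable_vec_lambda) auto
qed

lemma observed_subset_driving: "sets (observed t) \<subseteq> sets driving_algebra"
  using observation_measurable by (intro natural_filtration_subset) auto

lemma observed_subset: "sets (observed t) \<subseteq> sets N"
  using observed_subset_driving driving_subset by blast

section \<open>The law of the drivers as a function of the initial point\<close>

lemma initial_distribution:
  assumes "\<pi> \<in> unit_square" "y \<in> {0, 1}"
  shows "measure (M \<pi>) {\<omega>\<in>space N. Y i 0 \<omega> = y} = (if y = 1 then \<pi> $ i else 1 - \<pi> $ i)"
proof -
  interpret prob_space "M \<pi>" using assms(1) by (rule prob)
  have 1: "measure (M \<pi>) {\<omega>\<in>space N. Y i 0 \<omega> = 1} = \<pi> $ i"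
    using initial[OF assms(1), of i] by (simp add: space_M[OF assms(1)])
  have "{\<omega>\<in>space N. Y i 0 \<omega> = 1} \<in> sets N"
    using Y_meas_N[of 0 i] by measurable
  then have "measure (M \<pi>) (space N - {\<omega>\<in>space N. Y i 0 \<omega> = 1}) = 1 - \<pi> $ i"
    using prob_compl[of "{\<omega>\<in>space N. Y i 0 \<omega> = 1}"] 1 assms(1) by (simp add: space_M sets_M)
  moreover have "space N - {\<omega>\<in>space N. Y i 0 \<omega> = 1} = {\<omega>\<in>space N. Y i 0 \<omega> = 0}"
    using Y_values[of _ 0 i] by auto
  ultimately show ?thesis
    using assms(2) 1 by auto
qed

text \<open>Only coordinate \<open>i\<close> of the initial points enters. This generality also
  yields, with \<open>p = 0\<close>, that an unchanged coordinate has an unchanged law.\<close>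

lemma mixture_Y_law:
  assumes "\<pi> \<in> unit_square" "\<pi>0 \<in> unit_square" "\<pi>1 \<in> unit_square"
    and "\<pi> $ i = (1 - p) * \<pi>0 $ i + p * \<pi>1 $ i"
  shows "mixture_on {driver (Inl i) -` B \<inter> space N | B. B \<in> sets (\<Pi>\<^sub>M t\<in>{0..}. borel)}
    p (M \<pi>) (M \<pi>0) (M \<pi>1)"
proof -
  note sq = assms(1-3)
  have "mixture_on {{\<omega>\<in>space (M \<pi>). Y i 0 \<omega> = y} | y. y \<in> {0, 1}} p (M \<pi>) (M \<pi>0) (M \<pi>1)"
    using sq assms(4)
    by (intro mixture_onI) (auto simp: space_M initial_distribution algebra_simps)
  then have "mixture_on {(\<lambda>\<omega>. \<lambda>t\<in>{0..}. Y i t \<omega>) -` B \<inter> space (M \<pi>) | B. B \<in> sets (\<Pi>\<^sub>M t\<in>{0..}. borel)}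
    p (M \<pi>) (M \<pi>0) (M \<pi>1)"
    using sq sets_M chain prob Y_meas_N
    by (intro mixture_on_process_law markov_chain_disorder_fdd_mixture[where l = "lam $ i"])
      (auto simp: measurable_M)
  then show ?thesis
    by (simp add: driver_def[abs_def] space_M[OF sq(1)])
qed

lemma W_law_unique:
  assumes "\<pi> \<in> unit_square" "\<pi>0 \<in> unit_square" "B \<in> sets (\<Pi>\<^sub>M t\<in>{0..}. borel)"
  shows "measure (M \<pi>0) (driver (Inr i) -` B \<inter> space N) = measure (M \<pi>) (driver (Inr i) -` B \<inter> space N)"
proof -
  have "mixture_on {(\<lambda>\<omega>. \<lambda>t\<in>{0..}. W i t \<omega>) -` B \<inter> space (M \<pi>) | B. B \<in> sets (\<Pi>\<^sub>M t\<in>{0..}. borel)}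
    0 (M \<pi>) (M \<pi>0) (M \<pi>0)"
  proof (rule mixture_on_process_law)
    fix J and A :: "real \<Rightarrow> real set"
    assume J: "finite J" "J \<subseteq> {0..}" "\<And>t. t \<in> J \<Longrightarrow> A t \<in> sets borel"
    show "measure (M \<pi>) {\<omega>\<in>space (M \<pi>). \<forall>t\<in>J. W i t \<omega> \<in> A t} =
      (1 - 0) * measure (M \<pi>0) {\<omega>\<in>space (M \<pi>). \<forall>t\<in>J. W i t \<omega> \<in> A t} +
      0 * measure (M \<pi>0) {\<omega>\<in>space (M \<pi>). \<forall>t\<in>J. W i t \<omega> \<in> A t}"
      using brownian_fdd_unique[of "M \<pi>" "W i" "M \<pi>0" J A] J assms prob brownian space_M by simp
  qed (use assms prob sets_M W_meas_N in \<open>auto simp: measurable_M\<close>)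
  from mixture_on_CollectD[OF this assms(3)] show ?thesis
    by (simp add: driver_def[abs_def] space_M[OF assms(1)])
qed

text \<open>Moving coordinate \<open>i\<close> of the initial point alters the law of just one of
  the four independent drivers, namely \<open>Y i\<close>, and that law is affine in the
  coordinate.\<close>

lemma mixture_driving:
  assumes "coordinate_mixture i p \<pi> \<pi>0 \<pi>1"
  shows "mixture_on (sets driving_algebra) p (M \<pi>) (M \<pi>0) (M \<pi>1)"
proof -
  let ?S = "\<lambda>_::2+2. PiM {0::real..} (\<lambda>_. borel :: real measure)"
  have sq: "\<pi> \<in> unit_square" "\<pi>0 \<in> unit_square" "\<pi>1 \<in> unit_square"
    using assms by (auto simp: coordinate_mixture_def)
  have indep': "prob_space.indep_vars (M \<rho>) ?S driver UNIV" if "\<rho> \<in> unit_square" for \<rho>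
    using indep[OF that] by (simp add: driver_def[abs_def])
  have "mixture_on (sigma_sets (space (M \<pi>))
      {(\<Inter>k. driver k -` B k \<inter> space (M \<pi>)) | B. \<forall>k. B k \<in> sets (?S k)}) p (M \<pi>) (M \<pi>0) (M \<pi>1)"
  proof (rule mixture_on_independent[where m = "Inl i"])
    show "mixture_on {driver (Inl i) -` B \<inter> space (M \<pi>) |B. B \<in> sets (?S (Inl i))} p (M \<pi>) (M \<pi>0) (M \<pi>1)"
      using mixture_Y_law[OF sq, of i p] assms by (simp add: coordinate_mixture_def space_M)
  next
    fix k :: "2 + 2" and B Q
    assume k: "k \<noteq> Inl i" and B: "B \<in> sets (?S k)" and Q: "Q \<in> {M \<pi>0, M \<pi>1}"
    then obtain \<rho> where \<rho>: "Q = M \<rho>" "\<rho> \<in> unit_square" "\<And>j. j \<noteq> i \<Longrightarrow> \<rho> $ j = \<pi> $ j"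
      using assms by (auto simp: coordinate_mixture_def)
    show "measure Q (driver k -` B \<inter> space (M \<pi>)) = measure (M \<pi>) (driver k -` B \<inter> space (M \<pi>))"
    proof (cases k)
      case (Inl j)
      \<comment> \<open>Equality of the laws of \<open>Y j\<close> is read off as the degenerate
        mixture \<open>p = 0\<close>.\<close>
      then have "\<pi> $ j = (1 - 0) * \<rho> $ j + 0 * \<rho> $ j"
        using k \<rho>(3)[of j] by auto
      from mixture_on_CollectD[OF mixture_Y_law[OF sq(1) \<rho>(2) \<rho>(2) this] B]
      show ?thesis
        using Inl \<rho>(1) by (simp add: space_M[OF sq(1)])
    next
      case (Inr j)
      then show ?thesis
        using W_law_unique[OF sq(1) \<rho>(2) B, of j] \<rho>(1) by (simp add: space_M[OF sq(1)])
    qed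
  qed (use sq prob sets_M indep' in auto)
  then show ?thesis
    by (simp add: sets_driving space_M[OF sq(1)])
qed

lemma Y_event: "0 \<le> t \<Longrightarrow> {\<omega>\<in>space N. Y i t \<omega> = y} \<in> sets driving_algebra"
  using measurable_sets[OF Y_measurable, of t "{y}" i] by (simp add: vimage_def Int_def conj_commute)

lemma observed_Int_Y_event:
  assumes "C \<in> sets (observed s)" "0 \<le> t"
  shows "C \<inter> {\<omega>\<in>space N. Y i t \<omega> = y} \<in> sets driving_algebra"
  using observed_subset_driving[THEN subsetD, OF assms(1)] Y_event[OF assms(2)] by (rule sets.Int)

lemma mixture_emeasure:
  assumes mix: "coordinate_mixture i p \<pi> \<pi>0 \<pi>1" and A: "A \<in> sets driving_algebra"
  shows "emeasure (M \<pi>) A = ennreal (1 - p) * emeasure (M \<pi>0) A + ennreal p * emeasure (M \<pi>1) A"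
proof -
  have sq: "\<pi> \<in> unit_square" "\<pi>0 \<in> unit_square" "\<pi>1 \<in> unit_square" and p: "0 \<le> p" "p \<le> 1"
    using mix by (auto simp: coordinate_mixture_def)
  interpret P: prob_space "M \<pi>" using sq(1) by (rule prob)
  interpret P0: prob_space "M \<pi>0" using sq(2) by (rule prob)
  interpret P1: prob_space "M \<pi>1" using sq(3) by (rule prob)
  show ?thesis
    unfolding P.emeasure_eq_measure P0.emeasure_eq_measure P1.emeasure_eq_measure
      mixture_onD[OF mixture_driving[OF mix] A]
    using p by (simp add: ennreal_plus ennreal_mult)
qed

lemma Post_measurable_observed:
  assumes "\<pi> \<in> unit_square" "0 \<le> t"
  shows "(\<lambda>\<omega>. Post \<pi> t \<omega> $ i) \<in> borel_measurable (observed (ennreal t))"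
  using Post_adapted[OF assms] by (rule borel_measurable_vec_nth)

lemma Post_measurable: "\<pi> \<in> unit_square \<Longrightarrow> 0 \<le> t \<Longrightarrow> Post \<pi> t \<in> borel_measurable N"
  by (rule measurable_from_subalg[OF _ Post_adapted])
    (auto simp: subalgebra_def intro: observed_subset[THEN subsetD])

lemma observed_subalgebra:
  assumes "\<pi> \<in> unit_square"
  shows "finite_measure_subalgebra (M \<pi>) (observed t)"
proof -
  interpret prob_space "M \<pi>" using assms by (rule prob)
  show ?thesis
    by standard (use assms observed_subset sets_M space_M in \<open>auto simp: subalgebra_def\<close>)
qed

lemma Y_integrable:
  assumes "\<pi> \<in> unit_square" "0 \<le> t"
  shows "integrable (M \<pi>) (Y i t)"
proof -
  interpret prob_space "M \<pi>" using assms(1) by (rule prob)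
  show ?thesis
    using assms Y_values[OF _ assms(2), of _ i] Y_meas_N
    by (intro integrable_const_bound[where B = 1] AE_I2) (fastforce simp: space_M measurable_M)+
qed

lemma Post_right_continuous:
  assumes "\<pi> \<in> unit_square" "\<omega> \<in> space N" "0 \<le> t"
  shows "continuous (at_right t) (\<lambda>s. Post \<pi> s \<omega>)"
proof -
  have "continuous (at t within {0..}) (\<lambda>s. Post \<pi> s \<omega>)"
    using Post_cont[OF assms(1,2)] assms(3) by (simp add: continuous_on_eq_continuous_within)
  then show ?thesis
    by (rule continuous_within_subset) (use assms(3) in auto)
qed

text \<open>At each fixed time a conditional expectation of a variable with values 0 and 1 lies in
  the unit interval almost surely. Countably many rational times give one common null set, and
  continuity covers the remaining times, since every grid time is rational.\<close>

lemma Post_AE_unit_square: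
  assumes \<pi>: "\<pi> \<in> unit_square"
  shows "AE \<omega> in M \<pi>. \<forall>t\<ge>0. Post \<pi> t \<omega> \<in> unit_square"
proof -
  interpret prob_space "M \<pi>" using \<pi> by (rule prob)
  have "AE \<omega> in M \<pi>. 0 \<le> Post \<pi> t \<omega> $ i \<and> Post \<pi> t \<omega> $ i \<le> 1" if t: "0 \<le> t" for t i
  proof -
    interpret finite_measure_subalgebra "M \<pi>" "observed (ennreal t)"
      using \<pi> by (rule observed_subalgebra)
    have "AE \<omega> in M \<pi>. 0 \<le> Y i t \<omega>" "AE \<omega> in M \<pi>. Y i t \<omega> \<le> 1"
      using Y_values[OF _ t, of _ i] by (intro AE_I2; fastforce simp: space_M[OF \<pi>])+
    with Y_integrable[OF \<pi> t, of i] have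
      "AE \<omega> in M \<pi>. 0 \<le> real_cond_exp (M \<pi>) (observed (ennreal t)) (Y i t) \<omega>"
      "AE \<omega> in M \<pi>. real_cond_exp (M \<pi>) (observed (ennreal t)) (Y i t) \<omega> \<le> 1"
      by (intro real_cond_exp_ge_c real_cond_exp_le_c; simp)+
    with Post_cond_exp[OF \<pi> t, of i] show ?thesis
      by eventually_elim simp
  qed
  then have "AE \<omega> in M \<pi>. \<forall>r\<in>\<rat> \<inter> {0::real..}. \<forall>i. 0 \<le> Post \<pi> r \<omega> $ i \<and> Post \<pi> r \<omega> $ i \<le> 1"
    by (subst AE_ball_countable) (auto simp: countable_rat AE_all_countable)
  then show ?thesis
  proof (rule AE_mp, intro AE_I2 impI allI)
    fix \<omega> and t :: real assume \<omega>: "\<omega> \<in> space (M \<pi>)" and t: "0 \<le> t"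
      and rat: "\<forall>r\<in>\<rat> \<inter> {0::real..}. \<forall>i. 0 \<le> Post \<pi> r \<omega> $ i \<and> Post \<pi> r \<omega> $ i \<le> 1"

    have lim: "(\<lambda>n. Post \<pi> (grid_time n t) \<omega>) \<longlonglongrightarrow> Post \<pi> t \<omega>"
      using \<omega> t by (intro right_continuous_grid_limit[where f = "\<lambda>s. Post \<pi> s \<omega>"] Post_right_continuous[OF \<pi>])
        (auto simp: space_M[OF \<pi>])
    have "grid_time n t \<in> \<rat> \<inter> {0..}" for n
      using grid_time_gt[of t n] t by (auto simp: grid_time_def)
    with rat have bound: "0 \<le> Post \<pi> (grid_time n t) \<omega> $ i" "Post \<pi> (grid_time n t) \<omega> $ i \<le> 1" for n i
      by blast+
    have "0 \<le> Post \<pi> t \<omega> $ i" for i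
      by (rule tendsto_lowerbound[OF tendsto_vec_nth[OF lim]]) (use bound in auto)
    moreover have "Post \<pi> t \<omega> $ i \<le> 1" for i
      by (rule tendsto_upperbound[OF tendsto_vec_nth[OF lim]]) (use bound in auto)
    ultimately show "Post \<pi> t \<omega> \<in> unit_square"
      by (simp add: unit_square_def)
  qed
qed

text \<open>The defining property of conditional expectation removes the posterior: what remains
  depends on \<pi> only through the measure \<open>M \<pi>\<close> of an event that does not depend
  on \<pi>.\<close>

lemma nn_integral_Post:
  assumes \<pi>: "\<pi> \<in> unit_square" and t: "0 \<le> t" and B: "B \<in> sets (observed (ennreal t))"
  shows "(\<integral>\<^sup>+\<omega>\<in>B. ennreal (Post \<pi> t \<omega> $ i) \<partial>M \<pi>) = emeasure (M \<pi>) (B \<inter> {\<omega>\<in>space N. Y i t \<omega> = 1})"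
    and "(\<integral>\<^sup>+\<omega>\<in>B. ennreal (1 - Post \<pi> t \<omega> $ i) \<partial>M \<pi>) = emeasure (M \<pi>) (B \<inter> {\<omega>\<in>space N. Y i t \<omega> = 0})"
proof -
  interpret finite_measure_subalgebra "M \<pi>" "observed (ennreal t)"
    using \<pi> by (rule observed_subalgebra)
  interpret prob_space "M \<pi>" using \<pi> by (rule prob)
  let ?Y = "\<lambda>y. {\<omega>\<in>space N. Y i t \<omega> = y}"
  have BN: "B \<in> sets N" using B observed_subset by blast
  then have B_sub: "B \<subseteq> space N" by (rule sets.sets_into_space)
  have YN: "B \<inter> ?Y y \<in> sets (M \<pi>)" for y
    using Y_event[OF t, of i y] driving_subset BN sets_M[OF \<pi>] by auto
  have Post_int: "integrable (M \<pi>) (\<lambda>\<omega>. Post \<pi> t \<omega> $ i)"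
  proof (rule integrable_const_bound[where B = 1])
    show "AE \<omega> in M \<pi>. norm (Post \<pi> t \<omega> $ i) \<le> 1"
      using Post_AE_unit_square[OF \<pi>] by eventually_elim (use t in \<open>auto simp: unit_square_def\<close>)
    show "(\<lambda>\<omega>. Post \<pi> t \<omega> $ i) \<in> borel_measurable (M \<pi>)"
      using Post_measurable[OF \<pi> t] by (simp add: measurable_M[OF \<pi>])
  qed
  have ind_int: "integrable (M \<pi>) (indicat_real (B \<inter> ?Y y))" for y
    using YN by (intro integrable_const_bound[where B = 1]) auto
  have B_int: "integrable (M \<pi>) (indicat_real B)"
    using BN sets_M[OF \<pi>] by (intro integrable_const_bound[where B = 1]) auto
  have eq: "(\<integral>\<omega>. indicator B \<omega> * Post \<pi> t \<omega> $ i \<partial>M \<pi>) = measure (M \<pi>) (B \<inter> ?Y 1)"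
  proof -
    have "(\<integral>\<omega>. indicator B \<omega> * Post \<pi> t \<omega> $ i \<partial>M \<pi>) =
        (\<integral>\<omega>\<in>B. real_cond_exp (M \<pi>) (observed (ennreal t)) (Y i t) \<omega> \<partial>M \<pi>)"
      unfolding set_lebesgue_integral_def
    proof (rule integral_cong_AE)
      show "AE \<omega> in M \<pi>. indicator B \<omega> * Post \<pi> t \<omega> $ i =
          indicator B \<omega> *\<^sub>R real_cond_exp (M \<pi>) (observed (ennreal t)) (Y i t) \<omega>"
        using Post_cond_exp[OF \<pi> t, of i] by eventually_elim simp
    qed (use Post_int BN sets_M[OF \<pi>] in \<open>auto intro!: borel_measurable_times borel_measurable_scaleR\<close>)
    also have "\<dots> = (\<integral>\<omega>\<in>B. Y i t \<omega> \<partial>M \<pi>)"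
      by (rule real_cond_exp_intA[OF Y_integrable[OF \<pi> t] B, symmetric])
    also have "\<dots> = (\<integral>\<omega>. indicat_real (B \<inter> ?Y 1) \<omega> \<partial>M \<pi>)"
      unfolding set_lebesgue_integral_def
      using Y_values[OF _ t, of _ i]
      by (intro Bochner_Integration.integral_cong) (auto simp: space_M[OF \<pi>] indicator_def)
    also have "\<dots> = measure (M \<pi>) (B \<inter> ?Y 1)"
      using B_sub by (simp add: space_M[OF \<pi>] Int_absorb2 le_infI1)
    finally show ?thesis .
  qed
  have bounds: "AE \<omega> in M \<pi>. 0 \<le> Post \<pi> t \<omega> $ i \<and> Post \<pi> t \<omega> $ i \<le> 1"
    using Post_AE_unit_square[OF \<pi>] by eventually_elim (use t in \<open>auto simp: unit_square_def\<close>)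
  have int1: "integrable (M \<pi>) (\<lambda>\<omega>. indicator B \<omega> * Post \<pi> t \<omega> $ i)"
    using integrable_mult_indicator[OF _ Post_int, of B] BN sets_M[OF \<pi>] by simp
  have "(\<integral>\<^sup>+\<omega>\<in>B. ennreal (Post \<pi> t \<omega> $ i) \<partial>M \<pi>) = (\<integral>\<^sup>+\<omega>. ennreal (indicator B \<omega> * Post \<pi> t \<omega> $ i) \<partial>M \<pi>)"
    by (intro nn_integral_cong) (auto simp: indicator_def)
  also have "\<dots> = ennreal (\<integral>\<omega>. indicator B \<omega> * Post \<pi> t \<omega> $ i \<partial>M \<pi>)"
    by (intro nn_integral_eq_integral int1, use bounds in eventually_elim) (auto simp: indicator_def)
  finally show "(\<integral>\<^sup>+\<omega>\<in>B. ennreal (Post \<pi> t \<omega> $ i) \<partial>M \<pi>) = emeasure (M \<pi>) (B \<inter> ?Y 1)"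
    by (simp add: eq emeasure_eq_measure)
  have "(\<integral>\<^sup>+\<omega>\<in>B. ennreal (1 - Post \<pi> t \<omega> $ i) \<partial>M \<pi>) =
      (\<integral>\<^sup>+\<omega>. ennreal (indicator B \<omega> - indicator B \<omega> * Post \<pi> t \<omega> $ i) \<partial>M \<pi>)"
    by (intro nn_integral_cong) (auto simp: indicator_def)
  also have "\<dots> = ennreal (\<integral>\<omega>. indicator B \<omega> - indicator B \<omega> * Post \<pi> t \<omega> $ i \<partial>M \<pi>)"
    by (intro nn_integral_eq_integral Bochner_Integration.integrable_diff int1 B_int, use bounds in eventually_elim)
      (auto simp: indicator_def)
  also have "(\<integral>\<omega>. indicator B \<omega> - indicator B \<omega> * Post \<pi> t \<omega> $ i \<partial>M \<pi>) = measure (M \<pi>) B - measure (M \<pi>) (B \<inter> ?Y 1)"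
    using B_sub by (subst Bochner_Integration.integral_diff[OF B_int int1]) (simp add: eq space_M[OF \<pi>] Int_absorb2)
  also have "\<dots> = measure (M \<pi>) (B - B \<inter> ?Y 1)"
    using YN[of 1] BN sets_M[OF \<pi>] by (intro finite_measure_Diff[symmetric]) auto
  also have "B - B \<inter> ?Y 1 = B \<inter> ?Y 0"
    using B_sub Y_values[OF _ t, of _ i] by auto
  finally show "(\<integral>\<^sup>+\<omega>\<in>B. ennreal (1 - Post \<pi> t \<omega> $ i) \<partial>M \<pi>) = emeasure (M \<pi>) (B \<inter> ?Y 0)"
    by (simp add: emeasure_eq_measure)
qed

section \<open>Cost of stopping at a fixed time\<close>

abbreviation cost_at :: "real^2 \<Rightarrow> real \<Rightarrow> 'a set \<Rightarrow> ennreal" where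
  "cost_at \<pi> t B \<equiv> (\<integral>\<^sup>+\<omega>\<in>B. ennreal (g (Post \<pi> t \<omega>)) \<partial>M \<pi>)"

lemma cost_at_le:
  assumes "\<pi> \<in> unit_square" "0 \<le> t" "B \<in> sets (observed (ennreal t))"
  shows "cost_at \<pi> t B \<le> emeasure (M \<pi>) (B \<inter> {\<omega>\<in>space N. Y i t \<omega> = 0})"
  unfolding nn_integral_Post(2)[OF assms, symmetric]
  by (intro nn_integral_mono) (auto simp: indicator_def intro!: ennreal_leI g_le)

lemma cost_at_Un:
  assumes "\<pi> \<in> unit_square" "0 \<le> t" "B \<in> sets N" "C \<in> sets N" "B \<inter> C = {}"
  shows "cost_at \<pi> t (B \<union> C) = cost_at \<pi> t B + cost_at \<pi> t C"
proof -
  have "(\<lambda>\<omega>. ennreal (g (Post \<pi> t \<omega>))) \<in> borel_measurable (M \<pi>)"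
    using Post_measurable[OF assms(1,2)]
    by (auto simp: measurable_M[OF assms(1)] intro!: borel_measurable_g measurable_compose[OF _ measurable_ennreal])
  then show ?thesis
    using assms sets_M[OF assms(1)] by (intro nn_integral_disjoint_pair) auto
qed

text \<open>Deciding for the coordinate with the larger posterior is optimal, and the cost of a decision
  rule is an affine function of the law.\<close>

lemma optimal_decision:
  assumes \<pi>: "\<pi> \<in> unit_square" and t: "0 \<le> t" and B: "B \<in> sets (observed (ennreal t))"
  obtains C D where "C \<in> sets (observed (ennreal t))" "D \<in> sets (observed (ennreal t))"
    "C \<inter> D = {}" "C \<union> D = B"
    "cost_at \<pi> t B = emeasure (M \<pi>) (C \<inter> {\<omega>\<in>space N. Y 1 t \<omega> = 0}) + emeasure (M \<pi>) (D \<inter> {\<omega>\<in>space N. Y 2 t \<omega> = 0})"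
proof
  let ?E = "{\<omega>\<in>space N. Post \<pi> t \<omega> $ 1 \<ge> Post \<pi> t \<omega> $ 2}"
  have E: "?E \<in> sets (observed (ennreal t))"
    using borel_measurable_le[OF Post_measurable_observed[OF \<pi> t, of 2] Post_measurable_observed[OF \<pi> t, of 1]]
    by simp
  show C: "B \<inter> ?E \<in> sets (observed (ennreal t))" and D: "B - ?E \<in> sets (observed (ennreal t))"
    using B E by auto
  show "(B \<inter> ?E) \<inter> (B - ?E) = {}" "B \<inter> ?E \<union> (B - ?E) = B"
    by auto
  have "cost_at \<pi> t (B \<inter> ?E \<union> (B - ?E)) = cost_at \<pi> t (B \<inter> ?E) + cost_at \<pi> t (B - ?E)"
    using C D observed_subset by (intro cost_at_Un[OF \<pi> t]) auto
  also have "cost_at \<pi> t (B \<inter> ?E) = emeasure (M \<pi>) ((B \<inter> ?E) \<inter> {\<omega>\<in>space N. Y 1 t \<omega> = 0})"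
    unfolding nn_integral_Post(2)[OF \<pi> t C, symmetric]
    by (intro nn_integral_cong) (auto simp: indicator_def g_def)
  also have "cost_at \<pi> t (B - ?E) = emeasure (M \<pi>) ((B - ?E) \<inter> {\<omega>\<in>space N. Y 2 t \<omega> = 0})"
    unfolding nn_integral_Post(2)[OF \<pi> t D, symmetric]
    by (intro nn_integral_cong) (auto simp: indicator_def g_def space_M[OF \<pi>])
  also have "B \<inter> ?E \<union> (B - ?E) = B" by auto
  finally show "cost_at \<pi> t B = emeasure (M \<pi>) ((B \<inter> ?E) \<inter> {\<omega>\<in>space N. Y 1 t \<omega> = 0}) +
      emeasure (M \<pi>) ((B - ?E) \<inter> {\<omega>\<in>space N. Y 2 t \<omega> = 0})" .
qed

text \<open>The decision that is optimal under \<pi> is merely feasible under \<open>\<pi>0\<close>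
  and \<open>\<pi>1\<close>, and the cost of a fixed decision is affine in the law: a minimum of
  affine functions is concave.\<close>

lemma cost_at_concave:
  assumes mix: "coordinate_mixture i p \<pi> \<pi>0 \<pi>1" and t: "0 \<le> t" and B: "B \<in> sets (observed (ennreal t))"
  shows "ennreal (1 - p) * cost_at \<pi>0 t B + ennreal p * cost_at \<pi>1 t B \<le> cost_at \<pi> t B"
proof -
  have sq: "\<pi> \<in> unit_square" "\<pi>0 \<in> unit_square" "\<pi>1 \<in> unit_square"
    using mix by (auto simp: coordinate_mixture_def)
  obtain C D where CD: "C \<in> sets (observed (ennreal t))" "D \<in> sets (observed (ennreal t))"
    "C \<inter> D = {}" "C \<union> D = B" and
    cost: "cost_at \<pi> t B = emeasure (M \<pi>) (C \<inter> {\<omega>\<in>space N. Y 1 t \<omega> = 0}) + emeasure (M \<pi>) (D \<inter> {\<omega>\<in>space N. Y 2 t \<omega> = 0})"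
    by (rule optimal_decision[OF sq(1) t B])
  let ?C = "C \<inter> {\<omega>\<in>space N. Y 1 t \<omega> = 0}" and ?D = "D \<inter> {\<omega>\<in>space N. Y 2 t \<omega> = 0}"
  have le: "cost_at \<rho> t B \<le> emeasure (M \<rho>) ?C + emeasure (M \<rho>) ?D" if "\<rho> \<in> unit_square" for \<rho>
  proof -
    have "cost_at \<rho> t (C \<union> D) = cost_at \<rho> t C + cost_at \<rho> t D"
      using CD observed_subset by (intro cost_at_Un[OF that t]) auto
    then show ?thesis
      unfolding CD(4) using cost_at_le[OF that t] CD by (auto intro!: add_mono)
  qed
  have meas: "?C \<in> sets driving_algebra" "?D \<in> sets driving_algebra"
    using CD t by (auto intro!: observed_Int_Y_event)
  have "ennreal (1 - p) * cost_at \<pi>0 t B + ennreal p * cost_at \<pi>1 t B \<le>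
      ennreal (1 - p) * (emeasure (M \<pi>0) ?C + emeasure (M \<pi>0) ?D) +
      ennreal p * (emeasure (M \<pi>1) ?C + emeasure (M \<pi>1) ?D)"
    using le sq by (intro add_mono mult_left_mono) auto
  also have "\<dots> = emeasure (M \<pi>) ?C + emeasure (M \<pi>) ?D"
    unfolding mixture_emeasure[OF mix meas(1)] mixture_emeasure[OF mix meas(2)]
    by (simp add: distrib_left ac_simps)
  finally show ?thesis unfolding cost .
qed

text \<open>The opposite comparison: the decision optimal under \<open>\<pi>0\<close> is used under
  \<pi>. Its cost under \<open>\<pi>1\<close> is the probability of a wrong decision within
  \<open>B\<close>, hence at most the mass of \<open>B\<close>.\<close>

lemma cost_at_perturb:
  assumes mix: "coordinate_mixture i p \<pi> \<pi>0 \<pi>1" and t: "0 \<le> t" and B: "B \<in> sets (observed (ennreal t))"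
  shows "cost_at \<pi> t B \<le> ennreal (1 - p) * cost_at \<pi>0 t B + ennreal p * emeasure (M \<pi>1) B"
proof -
  have sq: "\<pi> \<in> unit_square" "\<pi>0 \<in> unit_square" "\<pi>1 \<in> unit_square"
    using mix by (auto simp: coordinate_mixture_def)
  obtain C D where CD: "C \<in> sets (observed (ennreal t))" "D \<in> sets (observed (ennreal t))"
    "C \<inter> D = {}" "C \<union> D = B" and
    cost: "cost_at \<pi>0 t B = emeasure (M \<pi>0) (C \<inter> {\<omega>\<in>space N. Y 1 t \<omega> = 0}) + emeasure (M \<pi>0) (D \<inter> {\<omega>\<in>space N. Y 2 t \<omega> = 0})"
    by (rule optimal_decision[OF sq(2) t B])
  let ?C = "C \<inter> {\<omega>\<in>space N. Y 1 t \<omega> = 0}" and ?D = "D \<inter> {\<omega>\<in>space N. Y 2 t \<omega> = 0}"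
  have meas: "?C \<in> sets driving_algebra" "?D \<in> sets driving_algebra"
    using CD t by (auto intro!: observed_Int_Y_event)
  have "cost_at \<pi> t (C \<union> D) = cost_at \<pi> t C + cost_at \<pi> t D"
    using CD observed_subset by (intro cost_at_Un[OF sq(1) t]) auto
  also have "\<dots> \<le> emeasure (M \<pi>) ?C + emeasure (M \<pi>) ?D"
    using cost_at_le[OF sq(1) t] CD by (auto intro!: add_mono)
  also have "\<dots> = ennreal (1 - p) * (emeasure (M \<pi>0) ?C + emeasure (M \<pi>0) ?D) +
      ennreal p * (emeasure (M \<pi>1) ?C + emeasure (M \<pi>1) ?D)"
    unfolding mixture_emeasure[OF mix meas(1)] mixture_emeasure[OF mix meas(2)]
    by (simp add: distrib_left ac_simps)
  also have "\<dots> \<le> ennreal (1 - p) * (emeasure (M \<pi>0) ?C + emeasure (M \<pi>0) ?D) + ennreal p * emeasure (M \<pi>1) B"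
  proof (intro add_left_mono mult_left_mono)
    have "emeasure (M \<pi>1) ?C + emeasure (M \<pi>1) ?D = emeasure (M \<pi>1) (?C \<union> ?D)"
      using meas driving_subset sets_M[OF sq(3)] CD(3) by (intro plus_emeasure) auto
    also have "\<dots> \<le> emeasure (M \<pi>1) B"
      using B observed_subset sets_M[OF sq(3)] CD(4) by (intro emeasure_mono) auto
    finally show "emeasure (M \<pi>1) ?C + emeasure (M \<pi>1) ?D \<le> emeasure (M \<pi>1) B" .
  qed simp
  finally show ?thesis
    unfolding CD(4) cost .
qed

subsection \<open>Stopping times\<close>

lemma stopping_time_measurable:
  assumes "stopping_time observed \<tau>" shows "\<tau> \<in> borel_measurable N"
  using assms
  by (intro measurable_stopping_time[where F = observed]) (auto intro: observed_subset[THEN subsetD])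

lemma Post_jointly_measurable:
  assumes "\<pi> \<in> unit_square"
  shows "(\<lambda>x. Post \<pi> (max 0 (fst x)) (snd x)) \<in> borel_measurable (borel \<Otimes>\<^sub>M N)"
  using assms by (intro right_continuous_jointly_measurable Post_measurable Post_right_continuous)

lemma Post_random_time_measurable:
  assumes "\<pi> \<in> unit_square" "f \<in> borel_measurable N" "\<And>\<omega>. 0 \<le> f \<omega>"
  shows "(\<lambda>\<omega>. Post \<pi> (f \<omega>) \<omega>) \<in> borel_measurable N"
  using measurable_compose[OF _ Post_jointly_measurable[OF assms(1)], of "\<lambda>\<omega>. (f \<omega>, \<omega>)" N] assms(2,3)
  by (simp add: max_absorb2)

lemma grid_time_measurable: "f \<in> borel_measurable M' \<Longrightarrow> (\<lambda>x. grid_time n (f x)) \<in> borel_measurable M'"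
  unfolding grid_time_def by (intro borel_measurable_divide borel_measurable_const) measurable

lemma grid_time_nonneg: "0 \<le> grid_time n s"
  by (simp add: grid_time_def)

text \<open>The part of \<open>\<tau> < \<infinity>\<close> on which the rounded time is
  \<open>(k + 1) / (n + 1)\<close>. Infinite values must be excluded by hand, since
  \<open>enn2real\<close> sends them to 0 and would put them in the slice
  \<open>k = 0\<close>.\<close>

definition stopping_slice :: "('a \<Rightarrow> ennreal) \<Rightarrow> nat \<Rightarrow> nat \<Rightarrow> 'a set" where
  "stopping_slice \<tau> n k = {\<omega>\<in>space N. \<tau> \<omega> < \<infinity> \<and> nat \<lfloor>real (Suc n) * enn2real (\<tau> \<omega>)\<rfloor> = k}"

text \<open>Rounding strictly upward makes the slice a half-open interval of values of
  \<open>\<tau>\<close>: a difference of two events of the form \<open>\<tau> < u\<close> with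
  \<open>u\<close> at most the rounded time.\<close>

lemma stopping_slice_observed:
  assumes "stopping_time observed \<tau>"
  shows "stopping_slice \<tau> n k \<in> sets (observed (ennreal (real (Suc k) / real (Suc n))))"
proof -
  let ?t = "real (Suc k) / real (Suc n)" and ?s = "real k / real (Suc n)"
  have iff: "nat \<lfloor>real (Suc n) * r\<rfloor> = k \<longleftrightarrow> ?s \<le> r \<and> r < ?t" if "0 \<le> r" for r
  proof -
    have "nat \<lfloor>real (Suc n) * r\<rfloor> = k \<longleftrightarrow> \<lfloor>real (Suc n) * r\<rfloor> = int k"
      using that by (simp add: nat_eq_iff)
    also have "\<dots> \<longleftrightarrow> real k \<le> real (Suc n) * r \<and> real (Suc n) * r < real (Suc k)"
      by (simp add: floor_eq_iff add.commute)
    also have "\<dots> \<longleftrightarrow> ?s \<le> r \<and> r < ?t"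
      by (subst pos_divide_le_eq, simp, subst pos_less_divide_eq) (auto simp: mult.commute)
    finally show ?thesis .
  qed
  have eq: "stopping_slice \<tau> n k = {\<omega>\<in>space N. \<tau> \<omega> < ennreal ?t} - {\<omega>\<in>space N. \<tau> \<omega> < ennreal ?s}"
  proof (intro set_eqI)
    fix \<omega>
    show "\<omega> \<in> stopping_slice \<tau> n k \<longleftrightarrow> \<omega> \<in> {\<omega>\<in>space N. \<tau> \<omega> < ennreal ?t} - {\<omega>\<in>space N. \<tau> \<omega> < ennreal ?s}"
    proof (cases "\<tau> \<omega>" rule: ennreal_cases)
      case (real r)
      then show ?thesis
        using iff[OF real(1)] by (auto simp: stopping_slice_def ennreal_less_iff)
    next
      case top
      then show ?thesis by (simp add: stopping_slice_def)
    qed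
  qed
  interpret filtration "space N" observed
    by standard (auto intro: natural_filtration_mono[THEN subsetD])
  have "{\<omega>\<in>space N. \<tau> \<omega> < ennreal u} \<in> sets (observed (ennreal ?t))" if "u \<le> ?t" for u
  proof -
    have "{\<omega>\<in>space N. \<tau> \<omega> < ennreal u} \<in> sets (observed (ennreal u))"
      using stopping_time_less_const[OF assms, of "ennreal u"] by (simp add: pred_def)
    then show ?thesis
      using natural_filtration_mono[OF ennreal_leI[OF that]] by blast
  qed
  moreover have "?s \<le> ?t"
    by (intro divide_right_mono) auto
  ultimately show ?thesis
    unfolding eq by (intro sets.Diff) blast+
qed

text \<open>The indicator overrides the default \<open>enn2real \<infinity> = 0\<close>, so that the
  quantity is the limit of its slice sums even for a law under which \<open>\<tau>\<close> may be
  infinite.\<close>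

definition stopped_cost :: "real^2 \<Rightarrow> ('a \<Rightarrow> ennreal) \<Rightarrow> ennreal" where
  "stopped_cost \<pi> \<tau> =
     (\<integral>\<^sup>+\<omega>. indicator {\<omega>. \<tau> \<omega> < \<infinity>} \<omega> * ennreal (g (Post \<pi> (enn2real (\<tau> \<omega>)) \<omega>)) \<partial>M \<pi>)"

text \<open>The slice sum is the cost at the rounded time, which is constant on each slice. Path
  continuity and continuity of \<open>g\<close> give pointwise convergence, and almost surely
  \<open>g\<close> is at most 1 along the posterior, so dominated convergence applies.\<close>

lemma stopped_cost_limit:
  assumes \<pi>: "\<pi> \<in> unit_square" and \<tau>: "stopping_time observed \<tau>"
  shows "(\<lambda>n. \<Sum>k. cost_at \<pi> (real (Suc k) / real (Suc n)) (stopping_slice \<tau> n k)) \<longlonglongrightarrow> stopped_cost \<pi> \<tau>"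
proof -
  interpret prob_space "M \<pi>" using \<pi> by (rule prob)
  let ?\<sigma> = "\<lambda>\<omega>. enn2real (\<tau> \<omega>)"
  let ?u = "\<lambda>n \<omega>. ennreal (g (Post \<pi> (grid_time n (?\<sigma> \<omega>)) \<omega>))"
  let ?F = "{\<omega>. \<tau> \<omega> < \<infinity>}"
  have \<tau>_meas [measurable]: "\<tau> \<in> borel_measurable N"
    using \<tau> by (rule stopping_time_measurable)
  have u_meas: "?u n \<in> borel_measurable N" for n
    by (intro measurable_compose[OF borel_measurable_g measurable_ennreal] Post_random_time_measurable[OF \<pi>]
        grid_time_measurable grid_time_nonneg) measurable
  have w_meas: "(\<lambda>\<omega>. ennreal (g (Post \<pi> (?\<sigma> \<omega>) \<omega>))) \<in> borel_measurable N"
    by (intro measurable_compose[OF borel_measurable_g measurable_ennreal] Post_random_time_measurable[OF \<pi>]) auto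
  have F_meas: "?F \<inter> space N \<in> sets N"
    by measurable
  have ind_meas: "(\<lambda>\<omega>. indicator ?F \<omega> :: ennreal) \<in> borel_measurable N"
    using F_meas by (simp add: borel_measurable_indicator_iff)
  have sum: "(\<Sum>k. cost_at \<pi> (real (Suc k) / real (Suc n)) (stopping_slice \<tau> n k)) =
      (\<integral>\<^sup>+\<omega>. indicator ?F \<omega> * ?u n \<omega> \<partial>M \<pi>)" for n
  proof -
    have "(\<integral>\<^sup>+\<omega>. indicator ?F \<omega> * ?u n \<omega> \<partial>M \<pi>) = (\<integral>\<^sup>+\<omega>\<in>(\<Union>k. stopping_slice \<tau> n k). ?u n \<omega> \<partial>M \<pi>)"
      by (intro nn_integral_cong) (auto simp: stopping_slice_def indicator_def space_M[OF \<pi>])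
    also have "\<dots> = (\<Sum>k. \<integral>\<^sup>+\<omega>\<in>stopping_slice \<tau> n k. ?u n \<omega> \<partial>M \<pi>)"
    proof (rule nn_integral_disjoint_family)
      show "stopping_slice \<tau> n k \<in> sets (M \<pi>)" for k
        using stopping_slice_observed[OF \<tau>] observed_subset sets_M[OF \<pi>] by blast
      show "disjoint_family (stopping_slice \<tau> n)"
        by (auto simp: disjoint_family_on_def stopping_slice_def)
    qed (use u_meas in \<open>simp add: measurable_M[OF \<pi>]\<close>)
    also have "\<dots> = (\<Sum>k. cost_at \<pi> (real (Suc k) / real (Suc n)) (stopping_slice \<tau> n k))"
      by (intro suminf_cong nn_integral_cong)
        (auto simp: stopping_slice_def indicator_def grid_time_def simp del: of_nat_Suc)
    finally show ?thesis by simp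
  qed
  have bounded: "AE \<omega> in M \<pi>. indicator ?F \<omega> * ?u n \<omega> \<le> 1" for n
    using Post_AE_unit_square[OF \<pi>]
    by eventually_elim (auto simp: indicator_def grid_time_nonneg intro!: g_le_one)
  have lim: "AE \<omega> in M \<pi>. (\<lambda>n. indicator ?F \<omega> * ?u n \<omega>) \<longlonglongrightarrow>
      indicator ?F \<omega> * ennreal (g (Post \<pi> (?\<sigma> \<omega>) \<omega>))"
  proof (rule AE_I2)
    fix \<omega> assume "\<omega> \<in> space (M \<pi>)"
    then have \<omega>: "\<omega> \<in> space N" by (simp add: space_M[OF \<pi>])
    have "(\<lambda>n. Post \<pi> (grid_time n (?\<sigma> \<omega>)) \<omega>) \<longlonglongrightarrow> Post \<pi> (?\<sigma> \<omega>) \<omega>"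
      by (intro right_continuous_grid_limit[where f = "\<lambda>s. Post \<pi> s \<omega>"] Post_right_continuous[OF \<pi> \<omega>]) simp_all
    then have "(\<lambda>n. g (Post \<pi> (grid_time n (?\<sigma> \<omega>)) \<omega>)) \<longlonglongrightarrow> g (Post \<pi> (?\<sigma> \<omega>) \<omega>)"
      by (intro continuous_on_tendsto_compose[OF continuous_on_g]) auto
    then show "(\<lambda>n. indicator ?F \<omega> * ?u n \<omega>) \<longlonglongrightarrow> indicator ?F \<omega> * ennreal (g (Post \<pi> (?\<sigma> \<omega>) \<omega>))"
      by (cases "\<tau> \<omega> < \<infinity>") auto
  qed
  have "(\<lambda>n. \<integral>\<^sup>+\<omega>. indicator ?F \<omega> * ?u n \<omega> \<partial>M \<pi>) \<longlonglongrightarrow> stopped_cost \<pi> \<tau>"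
    unfolding stopped_cost_def
    by (rule nn_integral_dominated_convergence[where w = "\<lambda>_. 1", OF _ _ _ bounded _ lim])
      (use u_meas w_meas ind_meas in \<open>auto simp: measurable_M[OF \<pi>] emeasure_space_1 intro!: borel_measurable_times_ennreal\<close>)
  then show ?thesis unfolding sum .
qed

lemma stopped_cost_concave:
  assumes mix: "coordinate_mixture i p \<pi> \<pi>0 \<pi>1" and \<tau>: "stopping_time observed \<tau>"
  shows "ennreal (1 - p) * stopped_cost \<pi>0 \<tau> + ennreal p * stopped_cost \<pi>1 \<tau> \<le> stopped_cost \<pi> \<tau>"
proof -
  have sq: "\<pi> \<in> unit_square" "\<pi>0 \<in> unit_square" "\<pi>1 \<in> unit_square"
    using mix by (auto simp: coordinate_mixture_def)
  let ?J = "\<lambda>\<rho> n. \<Sum>k. cost_at \<rho> (real (Suc k) / real (Suc n)) (stopping_slice \<tau> n k)"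
  have "ennreal (1 - p) * ?J \<pi>0 n + ennreal p * ?J \<pi>1 n \<le> ?J \<pi> n" for n
    unfolding ennreal_suminf_cmult[symmetric] suminf_add[OF summableI summableI]
    by (intro suminf_mono_ennreal cost_at_concave[OF mix] stopping_slice_observed[OF \<tau>]) auto
  moreover have "(\<lambda>n. ennreal (1 - p) * ?J \<pi>0 n + ennreal p * ?J \<pi>1 n) \<longlonglongrightarrow>
      ennreal (1 - p) * stopped_cost \<pi>0 \<tau> + ennreal p * stopped_cost \<pi>1 \<tau>"
    using sq \<tau> by (intro tendsto_add ennreal_tendsto_cmult stopped_cost_limit) auto
  ultimately show ?thesis
    by (intro LIMSEQ_le[OF _ stopped_cost_limit[OF sq(1) \<tau>]]) auto
qed

text \<open>The fixed-time perturbation bounds are summed; the slices are disjoint, so their masses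
  under \<open>\<pi>1\<close> add up to at most 1.\<close>

lemma stopped_cost_perturb:
  assumes mix: "coordinate_mixture i p \<pi> \<pi>0 \<pi>1" and \<tau>: "stopping_time observed \<tau>"
  shows "stopped_cost \<pi> \<tau> \<le> stopped_cost \<pi>0 \<tau> + ennreal p"
proof -
  have sq: "\<pi> \<in> unit_square" "\<pi>0 \<in> unit_square" "\<pi>1 \<in> unit_square" and p: "0 \<le> p" "p \<le> 1"
    using mix by (auto simp: coordinate_mixture_def)
  interpret P1: prob_space "M \<pi>1" using sq(3) by (rule prob)
  let ?J = "\<lambda>\<rho> n. \<Sum>k. cost_at \<rho> (real (Suc k) / real (Suc n)) (stopping_slice \<tau> n k)"
  have "?J \<pi> n \<le> ?J \<pi>0 n + ennreal p" for n
  proof -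
    have slice: "stopping_slice \<tau> n k \<in> sets (M \<pi>1)" for k
      using stopping_slice_observed[OF \<tau>] observed_subset sets_M[OF sq(3)] by blast
    have "(\<Sum>k. emeasure (M \<pi>1) (stopping_slice \<tau> n k)) = emeasure (M \<pi>1) (\<Union>k. stopping_slice \<tau> n k)"
      using slice by (intro suminf_emeasure) (auto simp: disjoint_family_on_def stopping_slice_def)
    then have total: "(\<Sum>k. emeasure (M \<pi>1) (stopping_slice \<tau> n k)) \<le> 1"
      by (simp add: P1.emeasure_le_1)
    have "?J \<pi> n \<le> (\<Sum>k. ennreal (1 - p) * cost_at \<pi>0 (real (Suc k) / real (Suc n)) (stopping_slice \<tau> n k) +
        ennreal p * emeasure (M \<pi>1) (stopping_slice \<tau> n k))"
      by (intro suminf_mono_ennreal cost_at_perturb[OF mix] stopping_slice_observed[OF \<tau>]) auto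
    also have "\<dots> = ennreal (1 - p) * ?J \<pi>0 n + ennreal p * (\<Sum>k. emeasure (M \<pi>1) (stopping_slice \<tau> n k))"
      unfolding ennreal_suminf_cmult[symmetric] suminf_add[OF summableI summableI] ..
    also have "\<dots> \<le> 1 * ?J \<pi>0 n + ennreal p * 1"
      using p total by (intro add_mono mult_right_mono mult_left_mono) (auto simp: ennreal_le_1)
    finally show ?thesis by simp
  qed
  moreover have "(\<lambda>n. ?J \<pi>0 n + ennreal p) \<longlonglongrightarrow> stopped_cost \<pi>0 \<tau> + ennreal p"
    using sq \<tau> by (intro tendsto_add stopped_cost_limit tendsto_const) auto
  ultimately show ?thesis
    by (intro LIMSEQ_le[OF stopped_cost_limit[OF sq(1) \<tau>]]) auto
qed

text \<open>Extended by 0 outside the interval from 0 to \<open>\<tau>\<close>, so that the time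
  integral runs over a fixed domain and can be exchanged with the expectation.\<close>

definition running_rate :: "real \<Rightarrow> real^2 \<Rightarrow> ('a \<Rightarrow> ennreal) \<Rightarrow> real \<Rightarrow> 'a \<Rightarrow> ennreal" where
  "running_rate c \<pi> \<tau> s \<omega> =
     (if 0 \<le> s \<and> ennreal s \<le> \<tau> \<omega> then ennreal (h c (Post \<pi> (max 0 s) \<omega>)) else 0)"

definition running_cost :: "real \<Rightarrow> real^2 \<Rightarrow> ('a \<Rightarrow> ennreal) \<Rightarrow> ennreal" where
  "running_cost c \<pi> \<tau> = (\<integral>\<^sup>+\<omega>. (\<integral>\<^sup>+s. running_rate c \<pi> \<tau> s \<omega> \<partial>lborel) \<partial>M \<pi>)"

lemma running_rate_measurable:
  assumes \<pi>: "\<pi> \<in> unit_square" and \<tau>: "stopping_time observed \<tau>"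
  shows "case_prod (running_rate c \<pi> \<tau>) \<in> borel_measurable (lborel \<Otimes>\<^sub>M M \<pi>)"
proof -
  have [measurable]: "\<tau> \<in> borel_measurable N"
    using \<tau> by (rule stopping_time_measurable)
  have [measurable]: "(\<lambda>x. ennreal (h c (Post \<pi> (max 0 (fst x)) (snd x)))) \<in> borel_measurable (borel \<Otimes>\<^sub>M N)"
    by (intro measurable_compose[OF borel_measurable_h measurable_ennreal] Post_jointly_measurable \<pi>)
  have "(\<lambda>x. if 0 \<le> fst x \<and> ennreal (fst x) \<le> \<tau> (snd x)
      then ennreal (h c (Post \<pi> (max 0 (fst x)) (snd x))) else 0) \<in> borel_measurable (borel \<Otimes>\<^sub>M N)"
    by measurable
  moreover have "case_prod (running_rate c \<pi> \<tau>) = (\<lambda>x. if 0 \<le> fst x \<and> ennreal (fst x) \<le> \<tau> (snd x)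
      then ennreal (h c (Post \<pi> (max 0 (fst x)) (snd x))) else 0)"
    by (auto simp: running_rate_def fun_eq_iff)
  moreover have "(borel_measurable (lborel \<Otimes>\<^sub>M M \<pi>) :: (real \<times> 'a \<Rightarrow> ennreal) set) = borel_measurable (borel \<Otimes>\<^sub>M N)"
    by (intro measurable_cong_sets sets_pair_measure_cong sets_M[OF \<pi>] sets_lborel refl)
  ultimately show ?thesis
    by (simp only:)
qed

lemma running_cost_swap:
  assumes \<pi>: "\<pi> \<in> unit_square" and \<tau>: "stopping_time observed \<tau>"
  shows "running_cost c \<pi> \<tau> = (\<integral>\<^sup>+s. (\<integral>\<^sup>+\<omega>. running_rate c \<pi> \<tau> s \<omega> \<partial>M \<pi>) \<partial>lborel)"
    and "(\<lambda>s. \<integral>\<^sup>+\<omega>. running_rate c \<pi> \<tau> s \<omega> \<partial>M \<pi>) \<in> borel_measurable lborel"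
    and "(\<lambda>\<omega>. \<integral>\<^sup>+s. running_rate c \<pi> \<tau> s \<omega> \<partial>lborel) \<in> borel_measurable (M \<pi>)"
proof -
  interpret prob_space "M \<pi>" using \<pi> by (rule prob)
  interpret pair_sigma_finite lborel "M \<pi>" ..
  note meas [measurable] = running_rate_measurable[OF assms, of c]
  show "running_cost c \<pi> \<tau> = (\<integral>\<^sup>+s. (\<integral>\<^sup>+\<omega>. running_rate c \<pi> \<tau> s \<omega> \<partial>M \<pi>) \<partial>lborel)"
    unfolding running_cost_def by (rule Fubini'[OF meas])
  show "(\<lambda>s. \<integral>\<^sup>+\<omega>. running_rate c \<pi> \<tau> s \<omega> \<partial>M \<pi>) \<in> borel_measurable lborel"
    by measurable
  show "(\<lambda>\<omega>. \<integral>\<^sup>+s. running_rate c \<pi> \<tau> s \<omega> \<partial>lborel) \<in> borel_measurable (M \<pi>)"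
    by measurable
qed

text \<open>The event \<open>s \<le> \<tau>\<close> is the complement of \<open>\<tau> < s\<close>
  and hence observed by time \<open>s\<close>, so the fixed-time identity replaces each posterior
  coordinate by the event \<open>Y i s = 1\<close>.\<close>

lemma running_rate_expectation:
  assumes \<pi>: "\<pi> \<in> unit_square" and \<tau>: "stopping_time observed \<tau>" and c: "0 \<le> c" and s: "0 \<le> s"
  shows "(\<integral>\<^sup>+\<omega>. running_rate c \<pi> \<tau> s \<omega> \<partial>M \<pi>) = ennreal c *
    (emeasure (M \<pi>) ({\<omega>\<in>space N. ennreal s \<le> \<tau> \<omega>} \<inter> {\<omega>\<in>space N. Y 1 s \<omega> = 1}) +
     emeasure (M \<pi>) ({\<omega>\<in>space N. ennreal s \<le> \<tau> \<omega>} \<inter> {\<omega>\<in>space N. Y 2 s \<omega> = 1}))"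
  (is "_ = _ * (emeasure _ (?B \<inter> _) + _)")
    and "{\<omega>\<in>space N. ennreal s \<le> \<tau> \<omega>} \<in> sets (observed (ennreal s))"
proof -
  interpret filtration "space N" observed
    by standard (auto intro: natural_filtration_mono[THEN subsetD])
  have "{\<omega>\<in>space N. \<tau> \<omega> < ennreal s} \<in> sets (observed (ennreal s))"
    using stopping_time_less_const[OF \<tau>, of "ennreal s"] by (simp add: pred_def)
  then have "space (observed (ennreal s)) - {\<omega>\<in>space N. \<tau> \<omega> < ennreal s} \<in> sets (observed (ennreal s))"
    by (rule sets.compl_sets)
  also have "space (observed (ennreal s)) - {\<omega>\<in>space N. \<tau> \<omega> < ennreal s} = ?B"
    by auto
  finally show B: "?B \<in> sets (observed (ennreal s))" .
  have Post_meas: "(\<lambda>\<omega>. ennreal (Post \<pi> s \<omega> $ i)) \<in> borel_measurable (M \<pi>)" for i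
    using Post_measurable[OF \<pi> s] unfolding measurable_M[OF \<pi>]
    by (intro measurable_compose[OF borel_measurable_vec_nth measurable_ennreal])
  have ind_meas: "(indicator ?B :: _ \<Rightarrow> ennreal) \<in> borel_measurable (M \<pi>)"
    unfolding measurable_M[OF \<pi>]
    by (rule borel_measurable_indicator[OF observed_subset[THEN subsetD, OF B]])
  have "(\<integral>\<^sup>+\<omega>. running_rate c \<pi> \<tau> s \<omega> \<partial>M \<pi>) = (\<integral>\<^sup>+\<omega>. ennreal c *
      (ennreal (Post \<pi> s \<omega> $ 1) * indicator ?B \<omega> + ennreal (Post \<pi> s \<omega> $ 2) * indicator ?B \<omega>) \<partial>M \<pi>)"
  proof (rule nn_integral_cong_AE, use Post_AE_unit_square[OF \<pi>] AE_space in eventually_elim)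
    case (elim \<omega>)
    then have "0 \<le> Post \<pi> s \<omega> $ i" for i
      using s by (auto simp: unit_square_def)
    then show ?case
      using s c elim(2) by (simp add: running_rate_def h_def indicator_def space_M[OF \<pi>] ennreal_mult ennreal_plus)
  qed
  also have "\<dots> = ennreal c * ((\<integral>\<^sup>+\<omega>\<in>?B. ennreal (Post \<pi> s \<omega> $ 1) \<partial>M \<pi>) + (\<integral>\<^sup>+\<omega>\<in>?B. ennreal (Post \<pi> s \<omega> $ 2) \<partial>M \<pi>))"
    using Post_meas ind_meas
    by (subst nn_integral_cmult, simp, subst nn_integral_add) auto
  finally show "(\<integral>\<^sup>+\<omega>. running_rate c \<pi> \<tau> s \<omega> \<partial>M \<pi>) = ennreal c *
    (emeasure (M \<pi>) (?B \<inter> {\<omega>\<in>space N. Y 1 s \<omega> = 1}) + emeasure (M \<pi>) (?B \<inter> {\<omega>\<in>space N. Y 2 s \<omega> = 1}))"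
    by (simp only: nn_integral_Post(1)[OF \<pi> s B])
qed

text \<open>No decision is taken in the running cost, so it is affine in the law, not merely
  concave.\<close>

lemma running_cost_mixture:
  assumes mix: "coordinate_mixture i p \<pi> \<pi>0 \<pi>1" and \<tau>: "stopping_time observed \<tau>" and c: "0 \<le> c"
  shows "running_cost c \<pi> \<tau> = ennreal (1 - p) * running_cost c \<pi>0 \<tau> + ennreal p * running_cost c \<pi>1 \<tau>"
proof -
  have sq: "\<pi> \<in> unit_square" "\<pi>0 \<in> unit_square" "\<pi>1 \<in> unit_square"
    using mix by (auto simp: coordinate_mixture_def)
  let ?K = "\<lambda>\<rho> s. \<integral>\<^sup>+\<omega>. running_rate c \<rho> \<tau> s \<omega> \<partial>M \<rho>"
  have "?K \<pi> s = ennreal (1 - p) * ?K \<pi>0 s + ennreal p * ?K \<pi>1 s" for s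
  proof (cases "0 \<le> s")
    case True
    note B = running_rate_expectation(2)[OF sq(1) \<tau> c True]
    show ?thesis
      unfolding running_rate_expectation(1)[OF sq(1) \<tau> c True] running_rate_expectation(1)[OF sq(2) \<tau> c True]
        running_rate_expectation(1)[OF sq(3) \<tau> c True]
        mixture_emeasure[OF mix observed_Int_Y_event[OF B True]]
      by (simp add: distrib_left ac_simps)
  qed (simp add: running_rate_def)
  then have "running_cost c \<pi> \<tau> = (\<integral>\<^sup>+s. (ennreal (1 - p) * ?K \<pi>0 s + ennreal p * ?K \<pi>1 s) \<partial>lborel)"
    using running_cost_swap(1)[OF sq(1) \<tau>] by simp
  also have "\<dots> = ennreal (1 - p) * running_cost c \<pi>0 \<tau> + ennreal p * running_cost c \<pi>1 \<tau>"
    unfolding running_cost_swap(1)[OF sq(2) \<tau>] running_cost_swap(1)[OF sq(3) \<tau>]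
    using running_cost_swap(2)[OF sq(2) \<tau>, of c] running_cost_swap(2)[OF sq(3) \<tau>, of c]
    by (subst nn_integral_add) (auto simp: nn_integral_cmult)
  finally show ?thesis .
qed

lemma expected_cost_eq:
  assumes \<pi>: "\<pi> \<in> unit_square" and \<tau>: "stopping_time observed \<tau>" and c: "0 \<le> c"
    and fin: "AE \<omega> in M \<pi>. \<tau> \<omega> < \<infinity>"
  shows "expected_cost (M \<pi>) c (Post \<pi>) \<tau> = stopped_cost \<pi> \<tau> + running_cost c \<pi> \<tau>"
proof -
  let ?S = "\<lambda>\<omega>. indicator {\<omega>. \<tau> \<omega> < \<infinity>} \<omega> * ennreal (g (Post \<pi> (enn2real (\<tau> \<omega>)) \<omega>))"
  let ?R = "\<lambda>\<omega>. \<integral>\<^sup>+s. running_rate c \<pi> \<tau> s \<omega> \<partial>lborel"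
  have [measurable]: "\<tau> \<in> borel_measurable N"
    using \<tau> by (rule stopping_time_measurable)
  have "?S \<in> borel_measurable N"
  proof (rule borel_measurable_times_ennreal)
    show "(\<lambda>\<omega>. ennreal (g (Post \<pi> (enn2real (\<tau> \<omega>)) \<omega>))) \<in> borel_measurable N"
      by (intro measurable_compose[OF borel_measurable_g measurable_ennreal] Post_random_time_measurable[OF \<pi>]) auto
    have "{\<omega>. \<tau> \<omega> < \<infinity>} \<inter> space N \<in> sets N"
      by measurable
    then show "(\<lambda>\<omega>. indicator {\<omega>. \<tau> \<omega> < \<infinity>} \<omega> :: ennreal) \<in> borel_measurable N"
      by (simp add: borel_measurable_indicator_iff)
  qed
  then have S_meas: "?S \<in> borel_measurable (M \<pi>)"
    by (simp add: measurable_M[OF \<pi>])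
  have "expected_cost (M \<pi>) c (Post \<pi>) \<tau> = (\<integral>\<^sup>+\<omega>. ?S \<omega> + ?R \<omega> \<partial>M \<pi>)"
    unfolding expected_cost_def
  proof (rule nn_integral_cong_AE, use Post_AE_unit_square[OF \<pi>] fin AE_space in eventually_elim)
    case (elim \<omega>)
    define \<sigma> where "\<sigma> = enn2real (\<tau> \<omega>)"
    have \<sigma>: "\<tau> \<omega> = ennreal \<sigma>" "0 \<le> \<sigma>"
      using elim(2) by (simp_all add: \<sigma>_def)
    have \<omega>: "\<omega> \<in> space N"
      using elim(3) by (simp add: space_M[OF \<pi>])
    have h_nonneg: "0 \<le> h c (Post \<pi> s \<omega>)" if "0 \<le> s" for s
      using elim(1) that c by (auto simp: h_def unit_square_def)
    have "continuous_on {0..\<sigma>} (\<lambda>s. Post \<pi> s \<omega>)"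
      using Post_cont[OF \<pi> \<omega>] by (rule continuous_on_subset) auto
    then have "continuous_on {0..\<sigma>} (\<lambda>s. h c (Post \<pi> s \<omega>))"
      unfolding h_def by (intro continuous_intros)
    \<comment> \<open>Integrability comes from continuity on a compact interval; it ensures that the
      Bochner integral in the cost is the true value and not the default 0.\<close>
    then have "set_integrable lborel {0..\<sigma>} (\<lambda>s. h c (Post \<pi> s \<omega>))"
      by (rule borel_integrable_atLeastAtMost')
    then have "ennreal (LINT s:{0..\<sigma>}|lborel. h c (Post \<pi> s \<omega>)) =
        (\<integral>\<^sup>+s. ennreal (indicator {0..\<sigma>} s *\<^sub>R h c (Post \<pi> s \<omega>)) \<partial>lborel)"
      unfolding set_lebesgue_integral_def set_integrable_def
      by (intro nn_integral_eq_integral[symmetric]) (auto simp: indicator_def h_nonneg)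
    also have "\<dots> = ?R \<omega>"
      using \<sigma> by (intro nn_integral_cong)
        (auto simp: running_rate_def indicator_def max_absorb2)
    finally have run: "ennreal (LINT s:{0..\<sigma>}|lborel. h c (Post \<pi> s \<omega>)) = ?R \<omega>" .
    have "0 \<le> g (Post \<pi> \<sigma> \<omega>)"
      using elim(1) \<sigma>(2) by (auto intro: g_nonneg)
    moreover have "0 \<le> (LINT s:{0..\<sigma>}|lborel. h c (Post \<pi> s \<omega>))"
      unfolding set_lebesgue_integral_def
      by (intro integral_nonneg_AE AE_I2) (auto simp: indicator_def h_nonneg)
    ultimately show ?case
      using elim(2) run by (simp add: ennreal_plus flip: \<sigma>_def)
  qed
  also have "\<dots> = stopped_cost \<pi> \<tau> + running_cost c \<pi> \<tau>"
    unfolding stopped_cost_def running_cost_def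
    by (rule nn_integral_add[OF S_meas running_cost_swap(3)[OF \<pi> \<tau>]])
  finally show ?thesis .
qed

subsection \<open>The value function\<close>

abbreviation V :: "real \<Rightarrow> real^2 \<Rightarrow> ennreal" where
  "V \<equiv> value_function M (observation \<mu> Y W) Post"

abbreviation admissible :: "real^2 \<Rightarrow> ('a \<Rightarrow> ennreal) set" where
  "admissible \<pi> \<equiv> admissible_times (M \<pi>) (observation \<mu> Y W)"

lemma admissible_iff:
  "\<pi> \<in> unit_square \<Longrightarrow> \<tau> \<in> admissible \<pi> \<longleftrightarrow> stopping_time observed \<tau> \<and> (AE \<omega> in M \<pi>. \<tau> \<omega> < \<infinity>)"
  by (simp add: admissible_times_def space_M)

lemma value_le:
  assumes "\<pi> \<in> unit_square" "stopping_time observed \<tau>" "0 \<le> c" "AE \<omega> in M \<pi>. \<tau> \<omega> < \<infinity>"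
  shows "V c \<pi> \<le> stopped_cost \<pi> \<tau> + running_cost c \<pi> \<tau>"
  unfolding value_function_def expected_cost_eq[OF assms, symmetric]
  using assms by (intro INF_lower) (simp add: admissible_iff)

text \<open>An infimum of concave functions is concave, but here the set of competing times depends
  on the initial point. Since both weights are strictly positive, a time that is almost surely
  finite under the mixture is so under both endpoints.\<close>

lemma value_unilaterally_concave:
  assumes mix: "coordinate_mixture i p \<pi> \<pi>0 \<pi>1" and p: "0 < p" "p < 1" and c: "0 \<le> c"
  shows "ennreal (1 - p) * V c \<pi>0 + ennreal p * V c \<pi>1 \<le> V c \<pi>"
proof -
  have sq: "\<pi> \<in> unit_square" "\<pi>0 \<in> unit_square" "\<pi>1 \<in> unit_square"
    using mix by (auto simp: coordinate_mixture_def)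
  show ?thesis
    unfolding value_function_def[of M "observation \<mu> Y W" Post c \<pi>]
  proof (rule INF_greatest)
    fix \<tau> assume "\<tau> \<in> admissible \<pi>"
    then have \<tau>: "stopping_time observed \<tau>" and fin: "AE \<omega> in M \<pi>. \<tau> \<omega> < \<infinity>"
      using sq by (auto simp: admissible_iff)
    \<comment> \<open>Measurability for \<open>N\<close> would be too weak: the mixture formula is
      available only for events of the driving algebra.\<close>
    have "\<tau> \<in> borel_measurable driving_algebra"
      by (intro measurable_stopping_time[OF \<tau>]) (auto intro: observed_subset_driving[THEN subsetD])
    then have "\<tau> -` {\<infinity>} \<inter> space driving_algebra \<in> sets driving_algebra"
      by (rule measurable_sets) simp
    then have I: "{\<omega>\<in>space N. \<not> \<tau> \<omega> < \<infinity>} \<in> sets driving_algebra"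
      by (simp add: vimage_def Int_def conj_commute less_top[symmetric])
    then have IN: "{\<omega>\<in>space N. \<not> \<tau> \<omega> < \<infinity>} \<in> sets N"
      using driving_subset by blast
    have AE_iff: "(AE \<omega> in M \<rho>. \<tau> \<omega> < \<infinity>) \<longleftrightarrow> emeasure (M \<rho>) {\<omega>\<in>space N. \<not> \<tau> \<omega> < \<infinity>} = 0"
      if "\<rho> \<in> unit_square" for \<rho>
      using IN sets_M[OF that] by (subst AE_iff_measurable[OF _ refl]) (auto simp: space_M[OF that])
    have "emeasure (M \<pi>) {\<omega>\<in>space N. \<not> \<tau> \<omega> < \<infinity>} = 0"
      using fin AE_iff[OF sq(1)] by blast
    then have "emeasure (M \<pi>0) {\<omega>\<in>space N. \<not> \<tau> \<omega> < \<infinity>} = 0" "emeasure (M \<pi>1) {\<omega>\<in>space N. \<not> \<tau> \<omega> < \<infinity>} = 0"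
      unfolding mixture_emeasure[OF mix I] using p by (auto simp: ennreal_eq_0_iff)
    then have fin': "AE \<omega> in M \<pi>0. \<tau> \<omega> < \<infinity>" "AE \<omega> in M \<pi>1. \<tau> \<omega> < \<infinity>"
      using AE_iff sq by auto
    have "ennreal (1 - p) * V c \<pi>0 + ennreal p * V c \<pi>1 \<le>
        ennreal (1 - p) * (stopped_cost \<pi>0 \<tau> + running_cost c \<pi>0 \<tau>) +
        ennreal p * (stopped_cost \<pi>1 \<tau> + running_cost c \<pi>1 \<tau>)"
      using sq \<tau> c fin' by (intro add_mono mult_left_mono value_le) auto
    also have "\<dots> = (ennreal (1 - p) * stopped_cost \<pi>0 \<tau> + ennreal p * stopped_cost \<pi>1 \<tau>) + running_cost c \<pi> \<tau>"
      unfolding running_cost_mixture[OF mix \<tau> c] by (simp add: distrib_left ac_simps)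
    also have "\<dots> \<le> stopped_cost \<pi> \<tau> + running_cost c \<pi> \<tau>"
      by (intro add_right_mono stopped_cost_concave[OF mix \<tau>])
    finally show "ennreal (1 - p) * V c \<pi>0 + ennreal p * V c \<pi>1 \<le> expected_cost (M \<pi>) c (Post \<pi>) \<tau>"
      unfolding expected_cost_eq[OF sq(1) \<tau> c fin] .
  qed
qed

lemma truncated_stopped_cost_limit:
  assumes \<pi>: "\<pi> \<in> unit_square" and \<tau>: "stopping_time observed \<tau>" and fin: "AE \<omega> in M \<pi>. \<tau> \<omega> < \<infinity>"
  shows "(\<lambda>n. stopped_cost \<pi> (\<lambda>\<omega>. min (\<tau> \<omega>) (of_nat n))) \<longlonglongrightarrow> stopped_cost \<pi> \<tau>"
proof -
  interpret prob_space "M \<pi>" using \<pi> by (rule prob)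
  let ?u = "\<lambda>\<tau> \<omega>. indicator {\<omega>. \<tau> \<omega> < \<infinity>} \<omega> * ennreal (g (Post \<pi> (enn2real (\<tau> \<omega>)) \<omega>))"
  have meas: "?u \<rho> \<in> borel_measurable (M \<pi>)" if [measurable]: "\<rho> \<in> borel_measurable N" for \<rho>
    unfolding measurable_M[OF \<pi>]
  proof (rule borel_measurable_times_ennreal)
    show "(\<lambda>\<omega>. ennreal (g (Post \<pi> (enn2real (\<rho> \<omega>)) \<omega>))) \<in> borel_measurable N"
      by (intro measurable_compose[OF borel_measurable_g measurable_ennreal] Post_random_time_measurable[OF \<pi>]) auto
    have "{\<omega>. \<rho> \<omega> < \<infinity>} \<inter> space N \<in> sets N"
      by measurable
    then show "(\<lambda>\<omega>. indicator {\<omega>. \<rho> \<omega> < \<infinity>} \<omega> :: ennreal) \<in> borel_measurable N"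
      by (simp add: borel_measurable_indicator_iff)
  qed
  have \<tau>_meas [measurable]: "\<tau> \<in> borel_measurable N"
    using \<tau> by (rule stopping_time_measurable)
  show ?thesis
    unfolding stopped_cost_def
  proof (rule nn_integral_dominated_convergence[where w = "\<lambda>_. 1"])
    show "AE \<omega> in M \<pi>. ?u (\<lambda>\<omega>. min (\<tau> \<omega>) (of_nat n)) \<omega> \<le> 1" for n
      using Post_AE_unit_square[OF \<pi>] by eventually_elim (auto simp: indicator_def intro!: g_le_one)
    show "AE \<omega> in M \<pi>. (\<lambda>n. ?u (\<lambda>\<omega>. min (\<tau> \<omega>) (of_nat n)) \<omega>) \<longlonglongrightarrow> ?u \<tau> \<omega>"
      using fin
    proof eventually_elim
      case (elim \<omega>)
      then obtain m :: nat where m: "\<tau> \<omega> < of_nat m"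
        using ennreal_Ex_less_of_nat by auto
      have "min (\<tau> \<omega>) (of_nat n) = \<tau> \<omega>" if "m \<le> n" for n
      proof -
        have "(of_nat m :: ennreal) \<le> of_nat n"
          using that by simp
        with m show ?thesis
          by (intro min_absorb1) (auto intro: less_imp_le order_trans)
      qed
      then show ?case
        by (intro tendsto_eventually eventually_sequentiallyI[of m]) (simp add: indicator_def)
    qed
    show "?u (\<lambda>\<omega>. min (\<tau> \<omega>) (of_nat n)) \<in> borel_measurable (M \<pi>)" for n
      by (rule meas) measurable
    show "?u \<tau> \<in> borel_measurable (M \<pi>)"
      by (rule meas) fact
  qed (auto simp: emeasure_space_1)
qed

lemma running_cost_mono:
  assumes "\<And>\<omega>. \<tau> \<omega> \<le> \<tau>' \<omega>"
  shows "running_cost c \<pi> \<tau> \<le> running_cost c \<pi> \<tau>'"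
  unfolding running_cost_def running_rate_def
  using order_trans[OF _ assms] by (intro nn_integral_mono) auto

lemma running_cost_bounded:
  assumes \<pi>: "\<pi> \<in> unit_square" and c: "0 \<le> c" and \<tau>: "\<And>\<omega>. \<tau> \<omega> \<le> of_nat n"
  shows "running_cost c \<pi> \<tau> \<le> ennreal (2 * c * real n)"
proof -
  interpret prob_space "M \<pi>" using \<pi> by (rule prob)
  have "running_cost c \<pi> \<tau> \<le> (\<integral>\<^sup>+\<omega>. (\<integral>\<^sup>+s. ennreal (2 * c) * indicator {0..real n} s \<partial>lborel) \<partial>M \<pi>)"
    unfolding running_cost_def
  proof (rule nn_integral_mono_AE, use Post_AE_unit_square[OF \<pi>] in eventually_elim)
    case (elim \<omega>)
    show ?case
    proof (rule nn_integral_mono)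
      fix s :: real
      have "s \<le> real n" if "ennreal s \<le> \<tau> \<omega>" "0 \<le> s"
        using order_trans[OF that(1) \<tau>] that(2) by (simp add: ennreal_of_nat_eq_real_of_nat)
      moreover have "h c (Post \<pi> s \<omega>) \<le> 2 * c" if "0 \<le> s"
      proof -
        have "Post \<pi> s \<omega> $ 1 + Post \<pi> s \<omega> $ 2 \<le> 2"
          using elim that by (auto simp: unit_square_def intro: order_trans[OF add_mono[of _ 1 _ 1]])
        from mult_left_mono[OF this c] show ?thesis
          by (simp add: h_def mult.commute)
      qed
      ultimately show "running_rate c \<pi> \<tau> s \<omega> \<le> ennreal (2 * c) * indicator {0..real n} s"
        by (auto simp: running_rate_def indicator_def max_absorb2 intro: ennreal_leI)
    qed
  qed
  also have "\<dots> = ennreal (2 * c * real n)"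
    using c by (simp add: nn_integral_cmult_indicator emeasure_space_1 ennreal_mult)
  finally show ?thesis .
qed

text \<open>A nearly optimal time may be infinite with positive probability under \<open>\<pi>1\<close>, so it is first
  truncated, which bounds its cost under every initial law.\<close>

lemma value_perturb:
  assumes \<pi>0: "\<pi>0 \<in> unit_square" and c: "0 \<le> c" and less: "V c \<pi>0 < ennreal r"
  obtains \<delta> where "\<delta> > 0"
    "\<And>i p \<pi> \<pi>1. coordinate_mixture i p \<pi> \<pi>0 \<pi>1 \<Longrightarrow> p < \<delta> \<Longrightarrow> V c \<pi> < ennreal r"
proof -
  obtain \<tau> where "\<tau> \<in> admissible \<pi>0" and cost: "expected_cost (M \<pi>0) c (Post \<pi>0) \<tau> < ennreal r"
    using less unfolding value_function_def INF_less_iff by blast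
  then have \<tau>: "stopping_time observed \<tau>" and fin: "AE \<omega> in M \<pi>0. \<tau> \<omega> < \<infinity>"
    using \<pi>0 by (auto simp: admissible_iff)
  let ?\<tau> = "\<lambda>n \<omega>. min (\<tau> \<omega>) (of_nat n :: ennreal)"
  have "(\<lambda>n. stopped_cost \<pi>0 (?\<tau> n) + running_cost c \<pi>0 \<tau>) \<longlonglongrightarrow> stopped_cost \<pi>0 \<tau> + running_cost c \<pi>0 \<tau>"
    by (intro tendsto_add truncated_stopped_cost_limit[OF \<pi>0 \<tau> fin] tendsto_const)
  then have "\<forall>\<^sub>F n in sequentially. stopped_cost \<pi>0 (?\<tau> n) + running_cost c \<pi>0 \<tau> < ennreal r"
    using cost unfolding expected_cost_eq[OF \<pi>0 \<tau> c fin] by (rule order_tendstoD(2))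
  then obtain n where n: "stopped_cost \<pi>0 (?\<tau> n) + running_cost c \<pi>0 \<tau> < ennreal r"
    by (auto simp: eventually_sequentially)
  have \<tau>n: "stopping_time observed (?\<tau> n)"
  proof -
    interpret filtration "space N" observed
      by standard (auto intro: natural_filtration_mono[THEN subsetD])
    show ?thesis
      using \<tau> by (intro stopping_time_min stopping_time_const)
  qed
  define A where "A = stopped_cost \<pi>0 (?\<tau> n) + running_cost c \<pi>0 (?\<tau> n)"
  have "A \<le> stopped_cost \<pi>0 (?\<tau> n) + running_cost c \<pi>0 \<tau>"
    unfolding A_def by (intro add_left_mono running_cost_mono) simp
  then have "A < ennreal r"
    using n by (rule le_less_trans)
  then obtain a where a: "A = ennreal a" "0 \<le> a" "a < r"
    by (cases A rule: ennreal_cases) (auto simp: ennreal_less_iff)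
  \<comment> \<open>Shifting weight \<open>p\<close> to \<open>\<pi>1\<close> adds at most
    \<open>p\<close> to the stopping cost and \<open>p * (2 * c * n)\<close> to the running cost of
    a time bounded by \<open>n\<close>; hence the total stays below \<open>r\<close> as soon as
    \<open>a + p * K < r\<close>.\<close>
  define K where "K = 1 + 2 * c * real n"
  have K: "K > 0" using c by (simp add: K_def add_pos_nonneg)
  show thesis
  proof
    show "(r - a) / K > 0" using a K by simp
    fix i p \<pi> \<pi>1 assume mix: "coordinate_mixture i p \<pi> \<pi>0 \<pi>1" and p_less: "p < (r - a) / K"
    have sq: "\<pi> \<in> unit_square" "\<pi>1 \<in> unit_square" and p: "0 \<le> p" "p \<le> 1"
      using mix by (auto simp: coordinate_mixture_def)
    have "V c \<pi> \<le> stopped_cost \<pi> (?\<tau> n) + running_cost c \<pi> (?\<tau> n)"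
      using sq \<tau>n c by (intro value_le AE_I2) (auto simp: min_less_iff_disj of_nat_less_top)
    also have "\<dots> \<le> (stopped_cost \<pi>0 (?\<tau> n) + ennreal p) +
        (1 * running_cost c \<pi>0 (?\<tau> n) + ennreal p * ennreal (2 * c * real n))"
      unfolding running_cost_mixture[OF mix \<tau>n c]
      using p sq c
      by (intro add_mono mult_right_mono mult_left_mono stopped_cost_perturb[OF mix \<tau>n] running_cost_bounded)
        (auto simp: ennreal_le_1)
    also have "\<dots> = A + (ennreal p + ennreal p * ennreal (2 * c * real n))"
      by (simp add: A_def ac_simps)
    also have "\<dots> = ennreal (a + (p + p * (2 * c * real n)))"
      using a p c by (simp add: ennreal_plus ennreal_mult)
    also have "a + (p + p * (2 * c * real n)) = a + p * K"
      by (simp add: K_def algebra_simps)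
    also have "ennreal (a + p * K) < ennreal r"
      using p_less K a p by (intro ennreal_lessI) (auto simp: pos_less_divide_eq)
    finally show "V c \<pi> < ennreal r" .
  qed
qed

subsection \<open>The boundary\<close>

text \<open>The comparison is with \<open>1 - y\<close> on the whole square, although this equals
  \<open>g\<close> only when \<open>x \<le> y\<close>. The affine function \<open>1 - y\<close> is
  what suits the concavity arguments.\<close>

abbreviation continue_at :: "real \<Rightarrow> real \<Rightarrow> real \<Rightarrow> bool" where
  "continue_at c x y \<equiv> V c (vector [x, y]) < ennreal (1 - y)"

lemma coordinate_mixture_vector:
  assumes "x \<in> {0..1}" "x' \<in> {0..1}" "y \<in> {0..1}" "p \<in> {0..1}"
  shows "coordinate_mixture 1 p (vector [(1 - p) * x + p * x', y]) (vector [x, y]) (vector [x', y])"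
    and "coordinate_mixture 2 p (vector [y, (1 - p) * x + p * x']) (vector [y, x]) (vector [y, x'])"
proof -
  have "0 \<le> (1 - p) * x + p * x'" "(1 - p) * x + p * x' \<le> 1"
    using assms convex_bound_le[of x 1 x' "1 - p" p] by auto
  then show "coordinate_mixture 1 p (vector [(1 - p) * x + p * x', y]) (vector [x, y]) (vector [x', y])"
    "coordinate_mixture 2 p (vector [y, (1 - p) * x + p * x']) (vector [y, x]) (vector [y, x'])"
    using assms by (simp_all add: coordinate_mixture_def unit_square_def forall_2)
qed

text \<open>Concavity on the vertical segment from \<open>y'\<close> up to 1. At the upper end
  \<open>1 - y\<close> vanishes, so the stopping inequality holds there for free by
  \<open>V \<ge> 0\<close>.\<close>

lemma not_continue_upward:
  assumes c: "0 \<le> c" and xy: "0 \<le> x" "x \<le> 1" "0 \<le> y'" "y' \<le> y" "y \<le> 1" and stop: "\<not> continue_at c x y'"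
  shows "\<not> continue_at c x y"
proof (cases "y = y' \<or> y = 1")
  case True
  then show ?thesis using stop by auto
next
  case False
  define p where "p = (y - y') / (1 - y')"
  have p: "0 < p" "p < 1" using False xy by (auto simp: p_def)
  have "(1 - p) * y' + p * 1 = y' + p * (1 - y')"
    by (simp add: algebra_simps)
  also have "\<dots> = y"
    using False xy by (simp add: p_def)
  finally have y: "(1 - p) * y' + p * 1 = y" .
  have "ennreal (1 - y) = ennreal (1 - p) * ennreal (1 - y')"
    using p xy by (subst ennreal_mult[symmetric]) (auto simp: y[symmetric] algebra_simps)
  also have "\<dots> \<le> ennreal (1 - p) * V c (vector [x, y'])"
    using stop by (intro mult_left_mono) auto
  also have "\<dots> \<le> ennreal (1 - p) * V c (vector [x, y']) + ennreal p * V c (vector [x, 1])"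
    by simp
  also have "\<dots> \<le> V c (vector [x, y])"
    using value_unilaterally_concave[OF coordinate_mixture_vector(2)[of y' 1 x p] p c] p xy y by simp
  finally show ?thesis by (simp add: not_less)
qed

text \<open>Along a horizontal segment \<open>1 - y\<close> is constant, so a concave function above
  it at both ends is above it in between.\<close>

lemma not_continue_between:
  assumes c: "0 \<le> c" and x: "0 \<le> x0" "x0 \<le> x" "x \<le> x1" "x1 \<le> 1" and y: "0 \<le> y" "y \<le> 1"
    and stop: "\<not> continue_at c x0 y" "\<not> continue_at c x1 y"
  shows "\<not> continue_at c x y"
proof (cases "x = x0 \<or> x = x1")
  case True
  then show ?thesis using stop by auto
next
  case False
  define p where "p = (x - x0) / (x1 - x0)"
  have p: "0 < p" "p < 1" using False x by (auto simp: p_def)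
  have "(1 - p) * x0 + p * x1 = x0 + p * (x1 - x0)"
    by (simp add: algebra_simps)
  also have "\<dots> = x"
    using False x by (simp add: p_def)
  finally have x': "(1 - p) * x0 + p * x1 = x" .
  have "ennreal (1 - y) = ennreal ((1 - p) * (1 - y) + p * (1 - y))"
    by (simp add: algebra_simps)
  also have "\<dots> = ennreal (1 - p) * ennreal (1 - y) + ennreal p * ennreal (1 - y)"
    using p y by (simp add: ennreal_plus ennreal_mult)
  also have "\<dots> \<le> ennreal (1 - p) * V c (vector [x0, y]) + ennreal p * V c (vector [x1, y])"
    using stop by (intro add_mono mult_left_mono) auto
  also have "\<dots> \<le> V c (vector [x, y])"
    using value_unilaterally_concave[OF coordinate_mixture_vector(1)[of x0 x1 y p] p c] p x x' y by simp
  finally show ?thesis by (simp add: not_less)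
qed

text \<open>This gives the strict inequality in the description of the continuation region: the
  supremum of continuation heights is never itself one of them.\<close>

lemma continue_open_upward:
  assumes c: "0 \<le> c" and xy: "0 \<le> x" "x \<le> 1" "0 \<le> y" and cont: "continue_at c x y"
  obtains y' where "y < y'" "y' \<le> 1" "continue_at c x y'"
proof -
  have y1: "y < 1" using cont by (metis ennreal_neg not_less not_less_zero diff_le_0_iff_le)
  from cont obtain v where v: "V c (vector [x, y]) = ennreal v" "0 \<le> v" "v < 1 - y"
    by (cases "V c (vector [x, y])" rule: ennreal_cases) (auto simp: ennreal_less_iff)
  \<comment> \<open>As \<open>y\<close> grows, the target \<open>1 - y\<close> shrinks. A level
    strictly between the value and the target leaves room for both changes.\<close>
  define r where "r = (v + (1 - y)) / 2"
  have r: "v < r" "r < 1 - y" "0 < r" using v by (auto simp: r_def)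
  have "vector [x, y] \<in> unit_square" using xy y1 by (simp add: unit_square_def forall_2)
  then obtain \<delta> where \<delta>: "\<delta> > 0"
    "\<And>i p \<pi> \<pi>1. coordinate_mixture i p \<pi> (vector [x, y]) \<pi>1 \<Longrightarrow> p < \<delta> \<Longrightarrow> V c \<pi> < ennreal r"
    using value_perturb[OF _ c, of "vector [x, y]" r] v r by (auto simp: ennreal_less_iff)
  \<comment> \<open>The first bound keeps the value below \<open>r\<close>; the second is equivalent
    to \<open>r \<le> (1 - p) * (1 - y)\<close>, the target at the new height.\<close>
  define p where "p = min (\<delta> / 2) (1 - r / (1 - y))"
  have p: "0 < p" "p < \<delta>" "p \<le> 1 - r / (1 - y)"
    using \<delta>(1) r y1 by (auto simp: p_def min_less_iff_disj)
  moreover have "0 < r / (1 - y)" using r y1 by simp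
  ultimately have p1: "p < 1" by simp
  let ?y = "(1 - p) * y + p * 1"
  have "V c (vector [x, ?y]) < ennreal r"
    using xy y1 p p1 by (intro \<delta>(2)[OF coordinate_mixture_vector(2)]) auto
  also have "ennreal r \<le> ennreal (1 - ?y)"
  proof (rule ennreal_leI)
    have "r = r / (1 - y) * (1 - y)" using y1 by simp
    also have "\<dots> \<le> (1 - p) * (1 - y)" using p y1 by (intro mult_right_mono) auto
    finally show "r \<le> 1 - ?y" by (simp add: algebra_simps)
  qed
  finally have "continue_at c x ?y" .
  moreover have "1 - ?y = (1 - p) * (1 - y)" "?y - y = p * (1 - y)" by (simp_all add: algebra_simps)
  then have "y < ?y" "?y \<le> 1"
    using p(1) p1 y1 by (smt (verit) mult_pos_pos)+
  ultimately show thesis using that by blast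
qed

lemma continue_open_sideways:
  assumes c: "0 \<le> c" and x: "x0 \<in> {0..1}" and y: "y \<in> {0..1}" and cont: "continue_at c x0 y"
  obtains \<epsilon> where "\<epsilon> > 0" "\<And>x. x \<in> {0..1} \<Longrightarrow> \<bar>x - x0\<bar> < \<epsilon> \<Longrightarrow> continue_at c x y"
proof -
  have "vector [x0, y] \<in> unit_square" using x y by (simp add: unit_square_def forall_2)
  then obtain \<delta> where \<delta>: "\<delta> > 0"
    "\<And>i p \<pi> \<pi>1. coordinate_mixture i p \<pi> (vector [x0, y]) \<pi>1 \<Longrightarrow> p < \<delta> \<Longrightarrow> V c \<pi> < ennreal (1 - y)"
    using value_perturb[OF _ c cont] by blast
  have toward: "continue_at c x y"
    if "e \<in> {0, 1}" "x0 \<noteq> e" "x \<in> {0..1}" "(x - x0) / (e - x0) \<in> {0..1}" "(x - x0) / (e - x0) < \<delta>" for x e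
  proof -
    define p where "p = (x - x0) / (e - x0)"
    have "(1 - p) * x0 + p * e = x0 + p * (e - x0)" by (simp add: algebra_simps)
    also have "\<dots> = x" using that(2) by (simp add: p_def)
    finally have "(1 - p) * x0 + p * e = x" .
    moreover have "coordinate_mixture 1 p (vector [(1 - p) * x0 + p * e, y]) (vector [x0, y]) (vector [e, y])"
      using that x y by (intro coordinate_mixture_vector) (auto simp: p_def)
    ultimately show ?thesis
      using \<delta>(2) that(5) by (auto simp: p_def)
  qed
  \<comment> \<open>A point to the right of \<open>x0\<close> is a mixture with the endpoint 1, one
    to the left with 0; the weight is the distance from \<open>x0\<close> divided by the distance
    from \<open>x0\<close> to that endpoint. The alternative 1 serves a side on which there is no
    point.\<close>
  define \<epsilon> where "\<epsilon> = \<delta> * min (if x0 < 1 then 1 - x0 else 1) (if 0 < x0 then x0 else 1)"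
  show thesis
  proof
    show "\<epsilon> > 0" using \<delta>(1) by (simp add: \<epsilon>_def)
    fix x assume x': "x \<in> {0..1}" and close: "\<bar>x - x0\<bar> < \<epsilon>"
    consider "x = x0" | "x0 < x" | "x < x0" by linarith
    then show "continue_at c x y"
    proof cases
      case 1
      then show ?thesis using cont by simp
    next
      case 2
      then have "x0 < 1" using x' by auto
      have "\<epsilon> \<le> \<delta> * (1 - x0)"
        unfolding \<epsilon>_def using \<delta>(1) \<open>x0 < 1\<close> by (intro mult_left_mono) auto
      then show ?thesis
        using 2 close x' \<open>x0 < 1\<close> by (intro toward[of 1]) (auto simp: pos_divide_less_eq)
    next
      case 3
      then have "0 < x0" using x' by auto
      have "\<epsilon> \<le> \<delta> * x0"
        unfolding \<epsilon>_def using \<delta>(1) \<open>0 < x0\<close> by (intro mult_left_mono) auto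
      moreover have "(x - x0) / (0 - x0) = (x0 - x) / x0"
        by (simp add: minus_divide_left)
      ultimately show ?thesis
        using 3 close x' \<open>0 < x0\<close> by (intro toward[of 0]) (auto simp: pos_divide_less_eq)
    qed
  qed
qed

text \<open>Inserting \<open>x\<close> keeps the set nonempty where no point above the diagonal
  continues, and yields \<open>b x \<ge> x\<close> in every case.\<close>

definition boundary :: "real \<Rightarrow> real \<Rightarrow> real" where
  "boundary c x = Sup (insert x {y\<in>{x..1}. continue_at c x y})"

lemma boundary_ge: "x \<in> {0..1} \<Longrightarrow> x \<le> boundary c x"
  unfolding boundary_def by (rule cSup_upper) (auto intro!: bdd_aboveI[of _ 1])

lemma boundary_le_one: "x \<in> {0..1} \<Longrightarrow> boundary c x \<le> 1"
  unfolding boundary_def by (rule cSup_least) auto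

lemma continue_iff_below_boundary:
  assumes c: "0 \<le> c" and xy: "0 \<le> x" "x \<le> y" "y \<le> 1"
  shows "continue_at c x y \<longleftrightarrow> y < boundary c x"
proof
  assume "continue_at c x y"
  then obtain y' where "y < y'" "y' \<le> 1" "continue_at c x y'"
    using continue_open_upward[OF c, of x y] xy by auto
  moreover from this xy have "y' \<le> boundary c x"
    unfolding boundary_def by (intro cSup_upper) (auto intro!: bdd_aboveI[of _ 1])
  ultimately show "y < boundary c x" by simp
next
  assume "y < boundary c x"
  \<comment> \<open>The inserted point is no candidate for \<open>y'\<close>, because
    \<open>x \<le> y < y'\<close>; so \<open>y'\<close> is a genuine continuation height above
    \<open>y\<close>.\<close>
  then obtain y' where "y' \<in> insert x {y\<in>{x..1}. continue_at c x y}" "y < y'"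
    unfolding boundary_def by (rule less_cSupE) auto
  then show "continue_at c x y"
    using not_continue_upward[OF c, of x y y'] xy by auto
qed

text \<open>A height strictly between \<open>y\<close> and the boundary continues at
  \<open>x\<close>, and continuation at that height persists for nearby abscissas. Below the
  diagonal the bound \<open>boundary c z \<ge> z\<close> alone suffices.\<close>

lemma boundary_lower_semicontinuous:
  assumes c: "0 \<le> c" shows "lower_semicontinuous_on {0..1} (boundary c)"
  unfolding lower_semicontinuous_on_def
proof (intro ballI allI impI)
  fix x y assume x: "x \<in> {0..1::real}" and y: "y < boundary c x"
  show "\<forall>\<^sub>F z in at x within {0..1}. y < boundary c z"
  proof (cases "y < x")
    case True
    have "y < boundary c z" if "z \<in> {0..1}" "dist z x < x - y" for z
      using boundary_ge[OF that(1), of c] that(2) by (auto simp: dist_real_def)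
    then show ?thesis
      using True unfolding eventually_at by (intro exI[of _ "x - y"]) auto
  next
    case False
    obtain y' where y': "y < y'" "y' < boundary c x"
      using dense[OF y] by blast
    have y'1: "y' \<le> 1" using y'(2) boundary_le_one[OF x, of c] by simp
    have "continue_at c x y'"
      using continue_iff_below_boundary[OF c, of x y'] x y' y'1 False by auto
    then obtain \<epsilon> where \<epsilon>: "\<epsilon> > 0" "\<And>z. z \<in> {0..1} \<Longrightarrow> \<bar>z - x\<bar> < \<epsilon> \<Longrightarrow> continue_at c z y'"
      using continue_open_sideways[OF c x, of y'] x y' y'1 False by auto
    \<comment> \<open>The bound \<open>y' - x\<close> keeps \<open>z \<le> y'\<close>, so that the
      point at height \<open>y'\<close> remains on or above the diagonal, where the boundary
      describes continuation.\<close>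
    have "y < boundary c z" if "z \<in> {0..1}" "dist z x < min \<epsilon> (y' - x)" for z
    proof -
      have "z \<le> y'" "\<bar>z - x\<bar> < \<epsilon>"
        using that(2) by (auto simp: dist_real_def)
      then have "y' < boundary c z"
        using continue_iff_below_boundary[OF c, of z y'] \<epsilon>(2)[OF that(1)] that(1) y'1 by auto
      then show ?thesis
        using y'(1) by simp
    qed
    then show ?thesis
      using \<epsilon>(1) y' False unfolding eventually_at by (intro exI[of _ "min \<epsilon> (y' - x)"]) auto
  qed
qed

text \<open>At the height \<open>m\<close> of the larger boundary value both outer points stop,
  hence so does the point between them. Since \<open>m \<ge> x1\<close>, the whole horizontal
  segment lies on or above the diagonal, where stopping at \<open>m\<close> means that the boundary
  is at most \<open>m\<close>.\<close>

lemma boundary_quasiconvex: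
  assumes c: "0 \<le> c" and "x0 \<in> {0..1}" "x1 \<in> {0..1}" "x0 \<le> x" "x \<le> x1"
  shows "boundary c x \<le> max (boundary c x0) (boundary c x1)"
proof -
  define m where "m = max (boundary c x0) (boundary c x1)"
  have m: "x1 \<le> m" "m \<le> 1"
    using boundary_ge[of x1 c] boundary_le_one[of x0 c] boundary_le_one[of x1 c] assms by (auto simp: m_def)
  have "\<not> continue_at c x0 m" "\<not> continue_at c x1 m"
    using continue_iff_below_boundary[OF c, of x0 m] continue_iff_below_boundary[OF c, of x1 m] m assms
    by (auto simp: m_def)
  then have "\<not> continue_at c x m"
    using not_continue_between[OF c, of x0 x x1 m] m assms by auto
  then show ?thesis
    using continue_iff_below_boundary[OF c, of x m] m assms by (auto simp: m_def)
qed

lemma continuation_region_below_boundary: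
  assumes c: "0 \<le> c"
  shows "continuation_region M (observation \<mu> Y W) Post c \<inter> upper_triangle
    = {\<pi> \<in> upper_triangle. \<pi> $ 2 < boundary c (\<pi> $ 1)}"
proof -
  have "V c \<pi> < ennreal (g \<pi>) \<longleftrightarrow> \<pi> $ 2 < boundary c (\<pi> $ 1)" if "\<pi> \<in> upper_triangle" for \<pi>
  proof -
    have "vector [\<pi> $ 1, \<pi> $ 2] = \<pi>" by (simp add: vec_eq_iff forall_2)
    moreover have "g \<pi> = 1 - \<pi> $ 2" using that by (simp add: g_def upper_triangle_def)
    ultimately show ?thesis
      using continue_iff_below_boundary[OF c, of "\<pi> $ 1" "\<pi> $ 2"] that
      by (simp add: upper_triangle_def unit_square_def)
  qed
  then show ?thesis
    unfolding continuation_region_def upper_triangle_def by auto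
qed

end

theorem proposition5p3:
  fixes N :: "'a measure" and M :: "real^2 \<Rightarrow> 'a measure"
    and \<mu> lam :: "real^2" and c :: real
    and Y W :: "2 \<Rightarrow> real \<Rightarrow> 'a \<Rightarrow> real"
    and Post :: "real^2 \<Rightarrow> real \<Rightarrow> 'a \<Rightarrow> real^2"
  assumes "\<mu> $ 1 > 0" and "\<mu> $ 2 > 0" and "lam $ 1 > 0" and "lam $ 2 > 0" and "c > 0"
    and "quickest_detection N M \<mu> lam Y W Post"
  shows "\<exists>b :: real \<Rightarrow> real.
    b \<in> {0..1} \<rightarrow> {0..1} \<and>
    (\<forall>x\<in>{0..1}. b x \<ge> x) \<and>
    continuation_region M (observation \<mu> Y W) Post c \<inter> upper_triangle
      = {\<pi> \<in> upper_triangle. \<pi> $ 2 < b (\<pi> $ 1)} \<and>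
    lower_semicontinuous_on {0..1} b \<and>
    nonincreasing_then_nondecreasing_on {0..1} b"
proof -
  interpret quickest_detection N M \<mu> lam Y W Post
    by fact
  have c: "0 \<le> c"
    using \<open>c > 0\<close> by simp
  have "nonincreasing_then_nondecreasing_on {0..1} (boundary c)"
    by (intro quasiconvex_imp_nonincreasing_then_nondecreasing boundary_quasiconvex[OF c])
      (auto simp: is_interval_1)
  moreover have "boundary c \<in> {0..1} \<rightarrow> {0..1}"
    using boundary_ge[of _ c] boundary_le_one[of _ c] by fastforce
  ultimately show ?thesis
    using boundary_ge boundary_lower_semicontinuous[OF c] continuation_region_below_boundary[OF c]
    by (intro exI[of _ "boundary c"]) auto
qed

end
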